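(* Let $\mathbb{B}$ be a bicategory and let $\eta_f,\varepsilon_f : f\dashv f^* : \mathcal{B}\to\mathcal{A}$ be an adjunction in $\mathbb{B}$ (so $f:\mathcal{A}\to\mathcal{B}$, $f^*:\mathcal{B}\to\mathcal{A}$) such that the functor $\mathbb{B}(f^*,\mathcal{A})=-\otimes f^* :\mathbb{B}(\mathcal{A},\mathcal{A})\to\mathbb{B}(\mathcal{B},\mathcal{A})$ is comonadic. Then there is an isomorphism of monoids $$\Gamma_{f^*}:\mathbf{I}^r_{\mathbb{B}(\mathcal{A},\mathcal{A})}(S_f)\to (\mathrm{End}_{\mathcal{B}}(\mathfrak{C}_f,\mathfrak{C}_f))^{\mathrm{op}}.$$
   Context: Bicategory conventions: 1-cells $\mathcal{A}\to\mathcal{B}$ are the objects of the hom-category $\mathbb{B}(\mathcal{A},\mathcal{B})$; the horizontal composite of $f:\mathcal{A}\to\mathcal{B}$ and $g:\mathcal{B}\to\mathcal{C}$ is written $g\otimes f$; a 1-cell also denotes its identity 2-cell. $\mathbb{B}(\mathcal{A},\mathcal{A})$ is a monoidal category under $\otimes$. An adjunction $\eta_f,\varepsilon_f:f\dashv f^*$ consists of 2-cells $\eta_f:1_{\mathcal{A}}\to f^*\otimes f$, $\varepsilon_f:f\otimes f^*\to 1_{\mathcal{B}}$ satisfying the triangle identities. $S_f$ is the monoid $(f^*\otimes f,m_f,\eta_f)$ in $\mathbb{B}(\mathcal{A},\mathcal{A})$, with $m_f$ given (up to the constraint isomorphisms) by $f^*\otimes\varepsilon_f\otimes f$. $\mathfrak{C}_f$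 is the comonoid $(f\otimes f^*,\delta_f,\varepsilon_f)$ in $\mathbb{B}(\mathcal{B},\mathcal{B})$, with $\delta_f$ given (up to constraints) by $f\otimes\eta_f\otimes f^*$. $\mathrm{End}_{\mathcal{B}}(\mathfrak{C}_f,\mathfrak{C}_f)$ is the monoid, under composition, of endomorphisms of the comonoid $\mathfrak{C}_f$; $(-)^{\mathrm{op}}$ is the opposite monoid. For a monoid $\mathbb{S}=(S,e_S,m_S)$ in a monoidal category $\mathcal{V}$, $\mathbf{I}^r_{\mathcal{V}}(\mathbb{S})$ is the class of subobjects $[(J,i_J:J\to S)]$ of $S$ (equivalence classes of monomorphisms into $S$) such that $m_S\cdot(i_J\otimes S):J\otimes S\to S$ is an isomorphism. When $X\otimes e_S$ is a monomorphism for all $X$ (which holds for $S_f$ under the hypothesis of the theorem), it is a monoid with product $[(J_1,i_{J_1})]\cdot[(J_2,i_{J_2})]=[(J_1\otimes J_2,\,m_S\cdot(i_{J_1}\otimes i_{J_2}))]$ and unit $[(I,e_S)]$. A functor $F$ with right adjoint $U$, unit $\eta$ and counit $\varepsilon$ is comonadic if the comparison functor $a\mapsto(F(a),F(\eta_a))$ to the category of coalgebras over the comonad $(FU,\varepsilon,F\eta U)$ is an equivalence. Here $-\otimes f^*$ has right adjoint $-\otimes f:\mathbb{B}(\mathcal{B},\mathcal{A})\to\mathbb{B}(\mathcal{A},\mathcal{A})$. *)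

theory Defs
  imports "HOL-Algebra.Group"
begin

section \<open>Categories\<close>

record ('o, 'm) category =
  Obj :: "'o set"
  Arr :: "'m set"
  Dom :: "'m \<Rightarrow> 'o"
  Cod :: "'m \<Rightarrow> 'o"
  ident :: "'o \<Rightarrow> 'm"
  Comp :: "'m \<Rightarrow> 'm \<Rightarrow> 'm"  (infixl "\<cdot>\<index>" 65)

definition Hom :: "('o, 'm, 'z) category_scheme \<Rightarrow> 'o \<Rightarrow> 'o \<Rightarrow> 'm set" where
  "Hom C a b = {h \<in> Arr C. Dom C h = a \<and> Cod C h = b}"

locale category =
  fixes C :: "('o, 'm, 'z) category_scheme" (structure)
  assumes Dom_Obj: "h \<in> Arr C \<Longrightarrow> Dom C h \<in> Obj C"
    and Cod_Obj: "h \<in> Arr C \<Longrightarrow> Cod C h \<in> Obj C"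
    and ident_Hom: "a \<in> Obj C \<Longrightarrow> ident C a \<in> Hom C a a"
    and Comp_Hom: "\<lbrakk>h \<in> Hom C a b; k \<in> Hom C b c\<rbrakk> \<Longrightarrow> k \<cdot> h \<in> Hom C a c"
    and Comp_ident_right: "h \<in> Hom C a b \<Longrightarrow> h \<cdot> ident C a = h"
    and Comp_ident_left: "h \<in> Hom C a b \<Longrightarrow> ident C b \<cdot> h = h"
    and Comp_assoc:
      "\<lbrakk>h \<in> Hom C a b; k \<in> Hom C b c; l \<in> Hom C c d\<rbrakk> \<Longrightarrow> l \<cdot> (k \<cdot> h) = (l \<cdot> k) \<cdot> h"

definition inverse_arrows :: "('o, 'm, 'z) category_scheme \<Rightarrow> 'm \<Rightarrow> 'm \<Rightarrow> bool" where
  "inverse_arrows C h k \<longleftrightarrow>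
     h \<in> Arr C \<and> k \<in> Hom C (Cod C h) (Dom C h) \<and>
     k \<cdot>\<^bsub>C\<^esub> h = ident C (Dom C h) \<and> h \<cdot>\<^bsub>C\<^esub> k = ident C (Cod C h)"

definition iso_arr :: "('o, 'm, 'z) category_scheme \<Rightarrow> 'm \<Rightarrow> bool" where
  "iso_arr C h \<longleftrightarrow> (\<exists>k. inverse_arrows C h k)"

definition inv_arr :: "('o, 'm, 'z) category_scheme \<Rightarrow> 'm \<Rightarrow> 'm" where
  "inv_arr C h = (THE k. inverse_arrows C h k)"

definition monic :: "('o, 'm, 'z) category_scheme \<Rightarrow> 'm \<Rightarrow> bool" where
  "monic C i \<longleftrightarrow> i \<in> Arr C \<and>
     (\<forall>x. \<forall>g \<in> Hom C x (Dom C i). \<forall>h \<in> Hom C x (Dom C i). i \<cdot>\<^bsub>C\<^esub> g = i \<cdot>\<^bsub>C\<^esub> h \<longrightarrow> g = h)"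

text \<open>The subobject represented by a monomorphism i. Since an arrow determines its domain, the
  arrow i alone stands for the pair consisting of its domain and i.\<close>

definition subobject :: "('o, 'm, 'z) category_scheme \<Rightarrow> 'm \<Rightarrow> 'm set" where
  "subobject C i = {j. monic C j \<and> Cod C j = Cod C i \<and>
     (\<exists>h \<in> Hom C (Dom C j) (Dom C i). iso_arr C h \<and> i \<cdot>\<^bsub>C\<^esub> h = j)}"


section \<open>Functors, adjunctions and comonadicity\<close>

record ('o, 'm, 'p, 'q) fctr =
  omap :: "'o \<Rightarrow> 'p"
  amap :: "'m \<Rightarrow> 'q"

locale is_functor = C: category C + D: category D
  for C :: "('o, 'm, 'y) category_scheme"
    and D :: "('p, 'q, 'z) category_scheme"
    and F :: "('o, 'm, 'p, 'q) fctr" +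
  assumes omap_Obj: "a \<in> Obj C \<Longrightarrow> omap F a \<in> Obj D"
    and amap_Hom: "h \<in> Hom C a b \<Longrightarrow> amap F h \<in> Hom D (omap F a) (omap F b)"
    and amap_ident: "a \<in> Obj C \<Longrightarrow> amap F (ident C a) = ident D (omap F a)"
    and amap_Comp: "\<lbrakk>h \<in> Hom C a b; k \<in> Hom C b c\<rbrakk> \<Longrightarrow>
      amap F (k \<cdot>\<^bsub>C\<^esub> h) = amap F k \<cdot>\<^bsub>D\<^esub> amap F h"

definition id_functor :: "('o, 'm, 'o, 'm) fctr" where
  "id_functor = \<lparr>omap = (\<lambda>a. a), amap = (\<lambda>h. h)\<rparr>"

definition comp_functor ::
    "('p, 'q, 'r, 's) fctr \<Rightarrow> ('o, 'm, 'p, 'q) fctr \<Rightarrow> ('o, 'm, 'r, 's) fctr" where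
  "comp_functor G F = \<lparr>omap = (\<lambda>a. omap G (omap F a)), amap = (\<lambda>h. amap G (amap F h))\<rparr>"

locale nat_trans = F: is_functor C D F + G: is_functor C D G
  for C :: "('o, 'm, 'y) category_scheme"
    and D :: "('p, 'q, 'z) category_scheme"
    and F :: "('o, 'm, 'p, 'q) fctr"
    and G :: "('o, 'm, 'p, 'q) fctr"
    and \<tau> :: "'o \<Rightarrow> 'q" +
  assumes component: "a \<in> Obj C \<Longrightarrow> \<tau> a \<in> Hom D (omap F a) (omap G a)"
    and naturality: "h \<in> Hom C a b \<Longrightarrow> \<tau> b \<cdot>\<^bsub>D\<^esub> amap F h = amap G h \<cdot>\<^bsub>D\<^esub> \<tau> a"

definition nat_iso ::
    "('o, 'm, 'y) category_scheme \<Rightarrow> ('p, 'q, 'z) category_scheme \<Rightarrow>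
     ('o, 'm, 'p, 'q) fctr \<Rightarrow> ('o, 'm, 'p, 'q) fctr \<Rightarrow> ('o \<Rightarrow> 'q) \<Rightarrow> bool" where
  "nat_iso C D F G \<tau> \<longleftrightarrow> nat_trans C D F G \<tau> \<and> (\<forall>a \<in> Obj C. iso_arr D (\<tau> a))"

definition equivalence_functor ::
    "('o, 'm, 'y) category_scheme \<Rightarrow> ('p, 'q, 'z) category_scheme \<Rightarrow>
     ('o, 'm, 'p, 'q) fctr \<Rightarrow> bool" where
  "equivalence_functor C D F \<longleftrightarrow> is_functor C D F \<and>
     (\<exists>G \<sigma> \<tau>. is_functor D C G \<and>
        nat_iso C C id_functor (comp_functor G F) \<sigma> \<and>
        nat_iso D D (comp_functor F G) id_functor \<tau>)"

locale adjoint_functors = F: is_functor C D F + U: is_functor D C U +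
    unit: nat_trans C C id_functor "comp_functor U F" \<eta> +
    counit: nat_trans D D "comp_functor F U" id_functor \<epsilon>
  for C :: "('o, 'm, 'y) category_scheme"
    and D :: "('p, 'q, 'z) category_scheme"
    and F :: "('o, 'm, 'p, 'q) fctr"
    and U :: "('p, 'q, 'o, 'm) fctr"
    and \<eta> :: "'o \<Rightarrow> 'm"
    and \<epsilon> :: "'p \<Rightarrow> 'q" +
  assumes triangle_F: "a \<in> Obj C \<Longrightarrow> \<epsilon> (omap F a) \<cdot>\<^bsub>D\<^esub> amap F (\<eta> a) = ident D (omap F a)"
    and triangle_U: "d \<in> Obj D \<Longrightarrow> amap U (\<epsilon> d) \<cdot>\<^bsub>C\<^esub> \<eta> (omap U d) = ident C (omap U d)"

text \<open>Coalgebras over a comonad with underlying endofunctor T, counit \<open>\<epsilon>\<close> and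
  comultiplication \<open>\<delta>\<close>. A morphism of coalgebras is tagged with its domain and codomain, because
  the same arrow may be a morphism between several pairs of coalgebras.\<close>

definition coalgebras ::
    "('p, 'q, 'z) category_scheme \<Rightarrow> ('p, 'q, 'p, 'q) fctr \<Rightarrow> ('p \<Rightarrow> 'q) \<Rightarrow> ('p \<Rightarrow> 'q) \<Rightarrow>
     ('p \<times> 'q) set" where
  "coalgebras D T \<epsilon> \<delta> = {(d, \<theta>). d \<in> Obj D \<and> \<theta> \<in> Hom D d (omap T d) \<and>
     \<epsilon> d \<cdot>\<^bsub>D\<^esub> \<theta> = ident D d \<and> amap T \<theta> \<cdot>\<^bsub>D\<^esub> \<theta> = \<delta> d \<cdot>\<^bsub>D\<^esub> \<theta>}"

definition Coalg ::
    "('p, 'q, 'z) category_scheme \<Rightarrow> ('p, 'q, 'p, 'q) fctr \<Rightarrow> ('p \<Rightarrow> 'q) \<Rightarrow> ('p \<Rightarrow> 'q) \<Rightarrow>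
     ('p \<times> 'q, ('p \<times> 'q) \<times> 'q \<times> ('p \<times> 'q)) category" where
  "Coalg D T \<epsilon> \<delta> =
     \<lparr>Obj = coalgebras D T \<epsilon> \<delta>,
      Arr = {(X, h, Y). X \<in> coalgebras D T \<epsilon> \<delta> \<and> Y \<in> coalgebras D T \<epsilon> \<delta> \<and>
               h \<in> Hom D (fst X) (fst Y) \<and> amap T h \<cdot>\<^bsub>D\<^esub> snd X = snd Y \<cdot>\<^bsub>D\<^esub> h},
      Dom = (\<lambda>(X, h, Y). X),
      Cod = (\<lambda>(X, h, Y). Y),
      ident = (\<lambda>X. (X, ident D (fst X), X)),
      Comp = (\<lambda>(Y', k, Z) (X, h, Y). (X, k \<cdot>\<^bsub>D\<^esub> h, Z))\<rparr>"

definition comparison ::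
    "('o, 'm, 'p, 'q) fctr \<Rightarrow> ('o \<Rightarrow> 'm) \<Rightarrow> ('o, 'm, 'y) category_scheme \<Rightarrow>
     ('o, 'm, 'p \<times> 'q, ('p \<times> 'q) \<times> 'q \<times> ('p \<times> 'q)) fctr" where
  "comparison F \<eta> C =
     \<lparr>omap = (\<lambda>a. (omap F a, amap F (\<eta> a))),
      amap = (\<lambda>h. ((omap F (Dom C h), amap F (\<eta> (Dom C h))), amap F h,
                   (omap F (Cod C h), amap F (\<eta> (Cod C h)))))\<rparr>"

definition comonadic ::
    "('o, 'm, 'y) category_scheme \<Rightarrow> ('p, 'q, 'z) category_scheme \<Rightarrow>
     ('o, 'm, 'p, 'q) fctr \<Rightarrow> ('p, 'q, 'o, 'm) fctr \<Rightarrow> ('o \<Rightarrow> 'm) \<Rightarrow> ('p \<Rightarrow> 'q) \<Rightarrow> bool" where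
  "comonadic C D F U \<eta> \<epsilon> \<longleftrightarrow> adjoint_functors C D F U \<eta> \<epsilon> \<and>
     equivalence_functor C
       (Coalg D (comp_functor F U) \<epsilon> (\<lambda>d. amap F (\<eta> (omap U d))))
       (comparison F \<eta> C)"


section \<open>Bicategories\<close>

text \<open>The 1-cells and 2-cells, with vertical composition, form the underlying category (the
  disjoint union of all hom-categories). Both horizontal compositions are in applicative order:
  for 1-cells f from a to b and g from b to c, \<open>g \<star> f\<close> goes from a to c.\<close>

record ('o, 'f, 'c) bicat = "('f, 'c) category" +
  Cells0 :: "'o set"
  Src :: "'f \<Rightarrow> 'o"
  Trg :: "'f \<Rightarrow> 'o"
  One :: "'o \<Rightarrow> 'f"
  HComp1 :: "'f \<Rightarrow> 'f \<Rightarrow> 'f"  (infixr "\<star>\<index>" 75)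
  HComp2 :: "'c \<Rightarrow> 'c \<Rightarrow> 'c"  (infixr "\<odot>\<index>" 75)
  Assoc :: "'f \<Rightarrow> 'f \<Rightarrow> 'f \<Rightarrow> 'c"
  Lunit :: "'f \<Rightarrow> 'c"
  Runit :: "'f \<Rightarrow> 'c"

locale bicategory = category B
  for B :: "('o, 'f, 'c, 'z) bicat_scheme" (structure) +
  assumes Src_Cells0: "f \<in> Obj B \<Longrightarrow> Src B f \<in> Cells0 B"
    and Trg_Cells0: "f \<in> Obj B \<Longrightarrow> Trg B f \<in> Cells0 B"
    and Src_parallel: "\<alpha> \<in> Hom B f f' \<Longrightarrow> Src B f = Src B f'"
    and Trg_parallel: "\<alpha> \<in> Hom B f f' \<Longrightarrow> Trg B f = Trg B f'"
    and One_cell: "a \<in> Cells0 B \<Longrightarrow> One B a \<in> Obj B \<and> Src B (One B a) = a \<and> Trg B (One B a) = a"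
    and HComp1_cell: "\<lbrakk>f \<in> Obj B; g \<in> Obj B; Trg B f = Src B g\<rbrakk> \<Longrightarrow>
      g \<star> f \<in> Obj B \<and> Src B (g \<star> f) = Src B f \<and> Trg B (g \<star> f) = Trg B g"
    and HComp2_Hom: "\<lbrakk>\<alpha> \<in> Hom B f f'; \<beta> \<in> Hom B g g'; Trg B f = Src B g\<rbrakk> \<Longrightarrow>
      \<beta> \<odot> \<alpha> \<in> Hom B (g \<star> f) (g' \<star> f')"
    and HComp2_ident: "\<lbrakk>f \<in> Obj B; g \<in> Obj B; Trg B f = Src B g\<rbrakk> \<Longrightarrow>
      ident B g \<odot> ident B f = ident B (g \<star> f)"
    and interchange:
      "\<lbrakk>\<alpha> \<in> Hom B f f'; \<alpha>' \<in> Hom B f' f''; \<beta> \<in> Hom B g g'; \<beta>' \<in> Hom B g' g'';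
        Trg B f = Src B g\<rbrakk> \<Longrightarrow>
      (\<beta>' \<cdot> \<beta>) \<odot> (\<alpha>' \<cdot> \<alpha>) = (\<beta>' \<odot> \<alpha>') \<cdot> (\<beta> \<odot> \<alpha>)"
    and Assoc_iso:
      "\<lbrakk>f \<in> Obj B; g \<in> Obj B; h \<in> Obj B; Trg B f = Src B g; Trg B g = Src B h\<rbrakk> \<Longrightarrow>
      Assoc B h g f \<in> Hom B ((h \<star> g) \<star> f) (h \<star> (g \<star> f)) \<and> iso_arr B (Assoc B h g f)"
    and Assoc_natural:
      "\<lbrakk>\<alpha> \<in> Hom B f f'; \<beta> \<in> Hom B g g'; \<gamma> \<in> Hom B h h'; Trg B f = Src B g; Trg B g = Src B h\<rbrakk> \<Longrightarrow>
      Assoc B h' g' f' \<cdot> ((\<gamma> \<odot> \<beta>) \<odot> \<alpha>) = (\<gamma> \<odot> (\<beta> \<odot> \<alpha>)) \<cdot> Assoc B h g f"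
    and Lunit_iso: "f \<in> Obj B \<Longrightarrow>
      Lunit B f \<in> Hom B (One B (Trg B f) \<star> f) f \<and> iso_arr B (Lunit B f)"
    and Lunit_natural: "\<alpha> \<in> Hom B f f' \<Longrightarrow>
      Lunit B f' \<cdot> (ident B (One B (Trg B f)) \<odot> \<alpha>) = \<alpha> \<cdot> Lunit B f"
    and Runit_iso: "f \<in> Obj B \<Longrightarrow>
      Runit B f \<in> Hom B (f \<star> One B (Src B f)) f \<and> iso_arr B (Runit B f)"
    and Runit_natural: "\<alpha> \<in> Hom B f f' \<Longrightarrow>
      Runit B f' \<cdot> (\<alpha> \<odot> ident B (One B (Src B f))) = \<alpha> \<cdot> Runit B f"
    and pentagon:
      "\<lbrakk>f \<in> Obj B; g \<in> Obj B; h \<in> Obj B; k \<in> Obj B;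
        Trg B f = Src B g; Trg B g = Src B h; Trg B h = Src B k\<rbrakk> \<Longrightarrow>
      (ident B k \<odot> Assoc B h g f) \<cdot> Assoc B k (h \<star> g) f \<cdot> (Assoc B k h g \<odot> ident B f) =
      Assoc B k h (g \<star> f) \<cdot> Assoc B (k \<star> h) g f"
    and triangle: "\<lbrakk>f \<in> Obj B; g \<in> Obj B; Trg B f = Src B g\<rbrakk> \<Longrightarrow>
      (ident B g \<odot> Lunit B f) \<cdot> Assoc B g (One B (Src B g)) f = Runit B g \<odot> ident B f"

definition HomCat :: "('o, 'f, 'c, 'z) bicat_scheme \<Rightarrow> 'o \<Rightarrow> 'o \<Rightarrow> ('f, 'c) category" where
  "HomCat B a b =
     \<lparr>Obj = {f \<in> Obj B. Src B f = a \<and> Trg B f = b},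
      Arr = {\<alpha> \<in> Arr B. Src B (Dom B \<alpha>) = a \<and> Trg B (Dom B \<alpha>) = b},
      Dom = Dom B, Cod = Cod B, ident = ident B, Comp = Comp B\<rparr>"

locale adjunction = bicategory B
  for B :: "('o, 'f, 'c, 'z) bicat_scheme" (structure)
    and a b :: 'o
    and f fs :: 'f
    and \<eta> \<epsilon> :: 'c +
  assumes Cells0_a: "a \<in> Cells0 B" and Cells0_b: "b \<in> Cells0 B"
    and left_cell: "f \<in> Obj (HomCat B a b)"
    and right_cell: "fs \<in> Obj (HomCat B b a)"
    and unit_cell: "\<eta> \<in> Hom B (One B a) (fs \<star> f)"
    and counit_cell: "\<epsilon> \<in> Hom B (f \<star> fs) (One B b)"
    and triangle_left:
      "Lunit B f \<cdot> (\<epsilon> \<odot> ident B f) \<cdot> inv_arr B (Assoc B f fs f) \<cdot> (ident B f \<odot> \<eta>) = Runit B f"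
    and triangle_right:
      "Runit B fs \<cdot> (ident B fs \<odot> \<epsilon>) \<cdot> Assoc B fs f fs \<cdot> (\<eta> \<odot> ident B fs) = Lunit B fs"

text \<open>For an adjunction with left adjoint f and right adjoint fs, \<open>precomp B fs\<close> is left adjoint to
  \<open>precomp B f\<close>; the next three definitions give these functors and the induced unit and counit.\<close>

definition precomp :: "('o, 'f, 'c, 'z) bicat_scheme \<Rightarrow> 'f \<Rightarrow> ('f, 'c, 'f, 'c) fctr" where
  "precomp B g = \<lparr>omap = (\<lambda>x. x \<star>\<^bsub>B\<^esub> g), amap = (\<lambda>\<alpha>. \<alpha> \<odot>\<^bsub>B\<^esub> ident B g)\<rparr>"

definition precomp_unit ::
    "('o, 'f, 'c, 'z) bicat_scheme \<Rightarrow> 'f \<Rightarrow> 'f \<Rightarrow> 'c \<Rightarrow> 'f \<Rightarrow> 'c" where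
  "precomp_unit B f fs \<eta> x =
     inv_arr B (Assoc B x fs f) \<cdot>\<^bsub>B\<^esub> (ident B x \<odot>\<^bsub>B\<^esub> \<eta>) \<cdot>\<^bsub>B\<^esub> inv_arr B (Runit B x)"

definition precomp_counit ::
    "('o, 'f, 'c, 'z) bicat_scheme \<Rightarrow> 'f \<Rightarrow> 'f \<Rightarrow> 'c \<Rightarrow> 'f \<Rightarrow> 'c" where
  "precomp_counit B f fs \<epsilon> y =
     Runit B y \<cdot>\<^bsub>B\<^esub> (ident B y \<odot>\<^bsub>B\<^esub> \<epsilon>) \<cdot>\<^bsub>B\<^esub> Assoc B y f fs"


section \<open>Monoids and comonoids in the endo-hom-categories\<close>

text \<open>The monoidal structure of \<open>HomCat B a a\<close> is given by \<open>\<star>\<close>, \<open>\<odot>\<close> and \<open>One B a\<close>.\<close>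

record ('f, 'c) monoid_object =
  mon_carrier :: 'f
  mon_unit :: 'c
  mon_mult :: 'c

record ('f, 'c) comonoid_object =
  comon_carrier :: 'f
  comon_comult :: 'c
  comon_counit :: 'c

definition adj_monoid ::
    "('o, 'f, 'c, 'z) bicat_scheme \<Rightarrow> 'f \<Rightarrow> 'f \<Rightarrow> 'c \<Rightarrow> 'c \<Rightarrow> ('f, 'c) monoid_object" where
  "adj_monoid B f fs \<eta> \<epsilon> =
     \<lparr>mon_carrier = fs \<star>\<^bsub>B\<^esub> f,
      mon_unit = \<eta>,
      mon_mult =
        (ident B fs \<odot>\<^bsub>B\<^esub> Lunit B f) \<cdot>\<^bsub>B\<^esub>
        (ident B fs \<odot>\<^bsub>B\<^esub> (\<epsilon> \<odot>\<^bsub>B\<^esub> ident B f)) \<cdot>\<^bsub>B\<^esub>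
        (ident B fs \<odot>\<^bsub>B\<^esub> inv_arr B (Assoc B f fs f)) \<cdot>\<^bsub>B\<^esub>
        Assoc B fs f (fs \<star>\<^bsub>B\<^esub> f)\<rparr>"

definition adj_comonoid ::
    "('o, 'f, 'c, 'z) bicat_scheme \<Rightarrow> 'f \<Rightarrow> 'f \<Rightarrow> 'c \<Rightarrow> 'c \<Rightarrow> ('f, 'c) comonoid_object" where
  "adj_comonoid B f fs \<eta> \<epsilon> =
     \<lparr>comon_carrier = f \<star>\<^bsub>B\<^esub> fs,
      comon_comult =
        inv_arr B (Assoc B f fs (f \<star>\<^bsub>B\<^esub> fs)) \<cdot>\<^bsub>B\<^esub>
        (ident B f \<odot>\<^bsub>B\<^esub> Assoc B fs f fs) \<cdot>\<^bsub>B\<^esub>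
        (ident B f \<odot>\<^bsub>B\<^esub> (\<eta> \<odot>\<^bsub>B\<^esub> ident B fs)) \<cdot>\<^bsub>B\<^esub>
        (ident B f \<odot>\<^bsub>B\<^esub> inv_arr B (Lunit B fs)),
      comon_counit = \<epsilon>\<rparr>"

text \<open>The product of two classes is the union of the classes of all products of representatives;
  it is again a single class because these products represent the same subobject.\<close>

definition Ir ::
    "('o, 'f, 'c, 'z) bicat_scheme \<Rightarrow> 'o \<Rightarrow> ('f, 'c) monoid_object \<Rightarrow> 'c set monoid" where
  "Ir B a S =
     \<lparr>carrier = {subobject (HomCat B a a) i | i.
        monic (HomCat B a a) i \<and> Cod B i = mon_carrier S \<and>
        iso_arr (HomCat B a a) (mon_mult S \<cdot>\<^bsub>B\<^esub> (i \<odot>\<^bsub>B\<^esub> ident B (mon_carrier S)))},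
      mult = (\<lambda>X Y. \<Union>i \<in> X. \<Union>j \<in> Y. subobject (HomCat B a a) (mon_mult S \<cdot>\<^bsub>B\<^esub> (i \<odot>\<^bsub>B\<^esub> j))),
      one = subobject (HomCat B a a) (mon_unit S)\<rparr>"

definition comonoid_End ::
    "('o, 'f, 'c, 'z) bicat_scheme \<Rightarrow> 'o \<Rightarrow> ('f, 'c) comonoid_object \<Rightarrow> 'c monoid" where
  "comonoid_End B b Q =
     \<lparr>carrier = {\<phi> \<in> Hom (HomCat B b b) (comon_carrier Q) (comon_carrier Q).
        (\<phi> \<odot>\<^bsub>B\<^esub> \<phi>) \<cdot>\<^bsub>B\<^esub> comon_comult Q = comon_comult Q \<cdot>\<^bsub>B\<^esub> \<phi> \<and>
        comon_counit Q \<cdot>\<^bsub>B\<^esub> \<phi> = comon_counit Q},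
      mult = Comp B,
      one = ident B (comon_carrier Q)\<rparr>"

definition opposite_monoid :: "'a monoid \<Rightarrow> 'a monoid" where
  "opposite_monoid M = M\<lparr>mult := (\<lambda>x y. y \<otimes>\<^bsub>M\<^esub> x)\<rparr>"

end

theory Submission
  imports Defs
begin

text \<open>Write S for \<open>fs \<star> f\<close>, Q for \<open>f \<star> fs\<close>, F for the functor
  \<open>x \<mapsto> x \<star> fs\<close> and U for its right adjoint \<open>y \<mapsto> y \<star> f\<close>. In the
  explanations all constraint isomorphisms are suppressed. Both monoids are compared with the set of
  coalgebra structures \<open>fs \<rightarrow> fs \<star> f \<star> fs\<close> on the 1-cell fs, for the comonad
  F U.

  Subobjects give coalgebra structures. An arrow \<open>i : J \<rightarrow> S = U fs\<close> has a transpose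
  \<open>\<beta> : F J \<rightarrow> fs\<close>, and \<open>m \<cdot> (i \<odot> S)\<close> is nothing but \<open>U \<beta>\<close>
  (\<open>adjunct_whisker\<close>). The functor U reflects the invertibility of \<open>\<beta>\<close>
  (\<open>U_reflects_iso_to_split\<close>), although it need not reflect isomorphisms in general. So the
  condition on i says that \<open>\<beta>\<close> is invertible. Then the coalgebra structure that the comparison
  functor puts on F J can be transported to fs, where it becomes
  \<open>\<theta> = F i \<cdot> \<beta>\<^sup>-\<^sup>1\<close>. Comonadicity says that up to isomorphism every coalgebra is
  such an F J, and that the morphisms between these coalgebras come from unique arrows. Hence every
  coalgebra structure on fs arises in this way, from a single subobject
  (\<open>coalgebra_structure_induced\<close>, \<open>induces_same_subobject\<close>). This half is a
  statement about an arbitrary comonadic functor.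

  Coalgebra structures are comonoid endomorphisms. Composing with f on the other side is left
  adjoint to composing with fs, so that the arrows \<open>fs \<rightarrow> fs \<star> f \<star> fs\<close> correspond to
  the arrows \<open>\<phi> : Q \<rightarrow> Q\<close>, the structure \<open>\<theta>\<close> being
  \<open>(fs \<odot> \<phi>) \<cdot> (\<eta> \<odot> fs)\<close>. Under this bijection the counit law for
  \<open>\<theta>\<close> is \<open>\<epsilon> \<cdot> \<phi> = \<epsilon>\<close> (\<open>counital_iff\<close>), and coassociativity
  is compatibility of \<open>\<phi>\<close> with the comultiplication (\<open>coassociative_iff\<close>).

  The composite bijection reverses products. If i and j correspond to \<open>\<phi>\<close> and
  \<open>\<psi>\<close>, then the product \<open>k = m \<cdot> (i \<odot> j)\<close> has the transpose
  \<open>\<beta>\<^sub>i \<cdot> (J\<^sub>i \<odot> \<beta>\<^sub>j)\<close>, and F k factors through it by the structure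
  that belongs to \<open>\<psi> \<cdot> \<phi>\<close> (\<open>coalg_mult\<close>, \<open>classifies_mult\<close>). The
  monoid laws for the subobjects are then inherited along the bijection.\<close>


section \<open>Isomorphisms and monomorphisms in a category\<close>

context category
begin

lemma comp_arr [simp]:
  assumes "h \<in> Arr C" "k \<in> Arr C" "Cod C h = Dom C k"
  shows "k \<cdot> h \<in> Arr C" "Dom C (k \<cdot> h) = Dom C h" "Cod C (k \<cdot> h) = Cod C k"
  using Comp_Hom[of h "Dom C h" "Dom C k" k "Cod C k"] assms by (auto simp: Hom_def)

lemma ident_arr [simp]:
  assumes "x \<in> Obj C"
  shows "ident C x \<in> Arr C" "Dom C (ident C x) = x" "Cod C (ident C x) = x"
  using ident_Hom[OF assms] by (auto simp: Hom_def)

lemma dom_cod_obj [simp]: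
  assumes "h \<in> Arr C"
  shows "Dom C h \<in> Obj C" "Cod C h \<in> Obj C"
  using assms Dom_Obj Cod_Obj by auto

lemma comp_assoc:
  assumes "h \<in> Arr C" "k \<in> Arr C" "l \<in> Arr C" "Cod C h = Dom C k" "Cod C k = Dom C l"
  shows "(l \<cdot> k) \<cdot> h = l \<cdot> (k \<cdot> h)"
  using Comp_assoc[of h "Dom C h" "Dom C k" k "Dom C l" l "Cod C l"] assms by (auto simp: Hom_def)

lemma comp_ident [simp]:
  assumes "h \<in> Arr C"
  shows "Dom C h = x \<Longrightarrow> h \<cdot> ident C x = h" "Cod C h = x \<Longrightarrow> ident C x \<cdot> h = h"
  using Comp_ident_right[of h "Dom C h" "Cod C h"] Comp_ident_left[of h "Dom C h" "Cod C h"] assms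
  by (auto simp: Hom_def)

lemma inverse_arrows_unique:
  assumes "inverse_arrows C h k" "inverse_arrows C h k'"
  shows "k = k'"
proof -
  have "(k \<cdot> h) \<cdot> k' = k \<cdot> (h \<cdot> k')"
    using assms unfolding inverse_arrows_def Hom_def by (intro comp_assoc) auto
  then have "k = (k \<cdot> h) \<cdot> k'"
    using assms unfolding inverse_arrows_def Hom_def by simp
  also have "\<dots> = k'"
    using assms unfolding inverse_arrows_def Hom_def by auto
  finally show ?thesis .
qed

lemma inverse_arrows_inv_arr: "iso_arr C h \<Longrightarrow> inverse_arrows C h (inv_arr C h)"
  unfolding iso_arr_def inv_arr_def by (metis inverse_arrows_unique theI)

lemma inv_arr_eq: "inverse_arrows C h k \<Longrightarrow> inv_arr C h = k"
  using inverse_arrows_inv_arr inverse_arrows_unique iso_arr_def by metis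

lemma iso_arr_arr: "iso_arr C h \<Longrightarrow> h \<in> Arr C"
  by (auto simp: iso_arr_def inverse_arrows_def)

lemma inv_arr [simp]:
  assumes "iso_arr C h"
  shows "inv_arr C h \<in> Arr C" "Dom C (inv_arr C h) = Cod C h" "Cod C (inv_arr C h) = Dom C h"
    "inv_arr C h \<cdot> h = ident C (Dom C h)" "h \<cdot> inv_arr C h = ident C (Cod C h)"
  using inverse_arrows_inv_arr[OF assms] by (auto simp: inverse_arrows_def Hom_def)

lemma inv_arr_cancel [simp]:
  assumes "iso_arr C h" "p \<in> Arr C"
  shows "Cod C p = Dom C h \<Longrightarrow> inv_arr C h \<cdot> (h \<cdot> p) = p"
    "Cod C p = Cod C h \<Longrightarrow> h \<cdot> (inv_arr C h \<cdot> p) = p"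
  using assms iso_arr_arr[OF assms(1)] by (simp_all flip: comp_assoc)

lemma iso_arrI:
  assumes "h \<in> Arr C" "k \<in> Arr C" "Dom C k = Cod C h" "Cod C k = Dom C h"
    "k \<cdot> h = ident C (Dom C h)" "h \<cdot> k = ident C (Cod C h)"
  shows "iso_arr C h" "inv_arr C h = k"
proof -
  have "inverse_arrows C h k"
    using assms by (auto simp: inverse_arrows_def Hom_def)
  then show "iso_arr C h" "inv_arr C h = k"
    using inv_arr_eq by (auto simp: iso_arr_def)
qed

lemma iso_arr_inv: "iso_arr C h \<Longrightarrow> iso_arr C (inv_arr C h)"
  using iso_arr_arr by (intro iso_arrI(1)[of _ h]) auto

lemma iso_arr_ident: "x \<in> Obj C \<Longrightarrow> iso_arr C (ident C x)"
  by (intro iso_arrI(1)[of _ "ident C x"]) auto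

lemma iso_arr_comp:
  assumes "iso_arr C h" "iso_arr C k" "Cod C h = Dom C k"
  shows "iso_arr C (k \<cdot> h)"
  using assms iso_arr_arr
  by (intro iso_arrI(1)[of _ "inv_arr C h \<cdot> inv_arr C k"]) (auto simp: comp_assoc)

lemma iso_arr_cancel_left:
  assumes "h \<cdot> p = h \<cdot> q" "iso_arr C h" "p \<in> Arr C" "q \<in> Arr C" "Cod C p = Dom C h"
    "Cod C q = Dom C h"
  shows "p = q"
  using assms inv_arr_cancel(1) by metis

lemma iso_arr_cancel_right:
  assumes "p \<cdot> h = q \<cdot> h" "iso_arr C h" "p \<in> Arr C" "q \<in> Arr C" "Dom C p = Cod C h"
    "Dom C q = Cod C h"
  shows "p = q"
proof -
  have "(p \<cdot> h) \<cdot> inv_arr C h = (q \<cdot> h) \<cdot> inv_arr C h"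
    using assms by simp
  then show ?thesis
    using assms(2-) iso_arr_arr[OF assms(2)] by (simp add: comp_assoc)
qed

lemma iso_arr_comp_iff:
  assumes "iso_arr C k" "h \<in> Arr C" "Dom C h = Cod C k"
  shows "iso_arr C (h \<cdot> k) \<longleftrightarrow> iso_arr C h"
proof
  assume hk: "iso_arr C (h \<cdot> k)"
  have "h = (h \<cdot> k) \<cdot> inv_arr C k"
    using assms iso_arr_arr by (simp add: comp_assoc)
  moreover have "iso_arr C ((h \<cdot> k) \<cdot> inv_arr C k)"
    using assms iso_arr_arr[OF assms(1)] by (intro iso_arr_comp[OF iso_arr_inv hk]) auto
  ultimately show "iso_arr C h" by metis
qed (use assms iso_arr_comp[of k h] in simp)

lemma iso_arr_square:
  assumes "h \<cdot> p = q \<cdot> k" "iso_arr C h" "iso_arr C k" "p \<in> Arr C" "q \<in> Arr C"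
    "Cod C p = Dom C h" "Cod C k = Dom C q"  "Dom C p = Dom C k" "Cod C q = Cod C h"
  shows "inv_arr C h \<cdot> q = p \<cdot> inv_arr C k"
proof -
  note [simp] = assms(2-) iso_arr_arr[OF assms(2)] iso_arr_arr[OF assms(3)]
  have "inv_arr C h \<cdot> q = inv_arr C h \<cdot> ((q \<cdot> k) \<cdot> inv_arr C k)"
    by (simp add: comp_assoc)
  also have "\<dots> = p \<cdot> inv_arr C k"
    by (simp add: comp_assoc flip: assms(1))
  finally show ?thesis .
qed

lemma monicD:
  assumes "monic C i" "i \<cdot> g = i \<cdot> h" "g \<in> Arr C" "h \<in> Arr C" "Cod C g = Dom C i"
    "Cod C h = Dom C i" "Dom C g = Dom C h"
  shows "g = h"
  using assms unfolding monic_def Hom_def by blast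

lemma subobject_refl: "monic C i \<Longrightarrow> i \<in> subobject C i"
  using iso_arr_ident[of "Dom C i"] unfolding subobject_def
  by (auto simp: Hom_def monic_def intro!: exI[of _ "ident C (Dom C i)"])

lemma subobject_subset:
  assumes "monic C i" "monic C j" "Cod C i = Cod C j" "iso_arr C h" "Dom C h = Dom C j"
    "Cod C h = Dom C i" "i \<cdot> h = j"
  shows "subobject C j \<subseteq> subobject C i"
proof
  fix k assume "k \<in> subobject C j"
  then obtain l where l: "monic C k" "Cod C k = Cod C j" "l \<in> Arr C" "Dom C l = Dom C k"
      "Cod C l = Dom C j" "iso_arr C l" "j \<cdot> l = k"
    by (auto simp: subobject_def Hom_def)
  have "i \<in> Arr C" using assms(1) by (simp add: monic_def)
  then have "(i \<cdot> h) \<cdot> l = i \<cdot> (h \<cdot> l)"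
    using l(3-6) assms(4-6) iso_arr_arr[OF assms(4)] by (intro comp_assoc) auto
  then have "i \<cdot> (h \<cdot> l) = k"
    using l(7) assms(7) by simp
  then show "k \<in> subobject C i"
    using l(1-6) assms(3-6) iso_arr_arr[OF assms(4)] iso_arr_comp[of l h]
    unfolding subobject_def Hom_def by (intro CollectI conjI bexI[of _ "h \<cdot> l"]) simp_all
qed

text \<open>Two monomorphisms that factor through each other represent the same subobject, because the
  two factorisations are then mutually inverse.\<close>

lemma subobject_eqI:
  assumes i: "monic C i" and j: "monic C j" and cod: "Cod C i = Cod C j"
    and h: "h \<in> Arr C" "Dom C h = Dom C j" "Cod C h = Dom C i" "i \<cdot> h = j"
    and k: "k \<in> Arr C" "Dom C k = Dom C i" "Cod C k = Dom C j" "j \<cdot> k = i"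
  shows "subobject C i = subobject C j"
proof -
  have arr: "i \<in> Arr C" "j \<in> Arr C"
    using i j by (auto simp: monic_def)
  have "i \<cdot> (h \<cdot> k) = (i \<cdot> h) \<cdot> k"
    using arr h(1-3) k(1-3) by (intro comp_assoc[symmetric]) auto
  also have "\<dots> = i \<cdot> ident C (Dom C i)"
    unfolding h(4) k(4) using arr by simp
  finally have "h \<cdot> k = ident C (Dom C i)"
    by (rule monicD[OF i]) (use arr h(1-3) k(1-3) in auto)
  moreover have "j \<cdot> (k \<cdot> h) = (j \<cdot> k) \<cdot> h"
    using arr h(1-3) k(1-3) by (intro comp_assoc[symmetric]) auto
  then have "j \<cdot> (k \<cdot> h) = j \<cdot> ident C (Dom C j)"
    unfolding h(4) k(4) using arr by simp
  then have "k \<cdot> h = ident C (Dom C j)"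
    by (rule monicD[OF j]) (use arr h(1-3) k(1-3) in auto)
  ultimately have "iso_arr C h" "iso_arr C k"
    using h k iso_arrI(1)[of h k] iso_arrI(1)[of k h] by simp_all
  then show ?thesis
    using subobject_subset[OF i j cod _ h(2-)] subobject_subset[OF j i cod[symmetric] _ k(2-)]
    by blast
qed

end


section \<open>Functors and equivalences\<close>

context is_functor
begin

lemma amap_arr [simp]:
  assumes "h \<in> Arr C"
  shows "amap F h \<in> Arr D" "Dom D (amap F h) = omap F (Dom C h)"
    "Cod D (amap F h) = omap F (Cod C h)"
  using amap_Hom[of h "Dom C h" "Cod C h"] assms by (auto simp: Hom_def)

lemma amap_comp [simp]:
  assumes "h \<in> Arr C" "k \<in> Arr C" "Cod C h = Dom C k"
  shows "amap F (k \<cdot>\<^bsub>C\<^esub> h) = amap F k \<cdot>\<^bsub>D\<^esub> amap F h"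
  using amap_Comp[of h "Dom C h" "Dom C k" k "Cod C k"] assms by (auto simp: Hom_def)

lemmas functor_simps [simp] = omap_Obj amap_ident

lemma preserves_iso:
  assumes "iso_arr C h"
  shows "iso_arr D (amap F h)"
proof -
  have h: "h \<in> Arr C"
    using assms C.iso_arr_arr by simp
  have "amap F (inv_arr C h) \<cdot>\<^bsub>D\<^esub> amap F h = ident D (omap F (Dom C h))"
    "amap F h \<cdot>\<^bsub>D\<^esub> amap F (inv_arr C h) = ident D (omap F (Cod C h))"
    using assms h by (simp_all flip: amap_comp)
  then show ?thesis
    using assms h by (intro D.iso_arrI(1)[of _ "amap F (inv_arr C h)"]) auto
qed

end

lemma equivalence_functor_faithful:
  assumes "equivalence_functor C D F"
    and "h \<in> Hom C x y" "k \<in> Hom C x y" "amap F h = amap F k"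
  shows "h = k"
proof -
  from assms obtain G \<sigma> where F: "is_functor C D F" and G: "is_functor D C G"
    and \<sigma>: "nat_trans C C id_functor (comp_functor G F) \<sigma>" "\<forall>a \<in> Obj C. iso_arr C (\<sigma> a)"
    unfolding equivalence_functor_def nat_iso_def by blast
  interpret F: is_functor C D F by (rule F)
  interpret \<sigma>: nat_trans C C id_functor "comp_functor G F" \<sigma> by (rule \<sigma>)
  have "\<sigma> y \<cdot>\<^bsub>C\<^esub> h = \<sigma> y \<cdot>\<^bsub>C\<^esub> k"
    using \<sigma>.naturality[OF assms(2)] \<sigma>.naturality[OF assms(3)] assms(4)
    by (simp add: id_functor_def comp_functor_def)
  then show ?thesis
    by (rule F.C.iso_arr_cancel_left[where h = "\<sigma> y"])
      (use assms(2,3) \<sigma>(2) \<sigma>.component[of y] F.C.dom_cod_obj[of h]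
        in \<open>auto simp: Hom_def id_functor_def\<close>)
qed

text \<open>The pseudo-inverse G is itself an equivalence, hence faithful; so it is enough to find a
  preimage of its value under G, and conjugation with the unit gives one.\<close>

lemma equivalence_functor_full:
  assumes "equivalence_functor C D F" "x \<in> Obj C" "y \<in> Obj C"
    and "g \<in> Hom D (omap F x) (omap F y)"
  shows "\<exists>h \<in> Hom C x y. amap F h = g"
proof -
  from assms obtain G \<sigma> \<tau> where F: "is_functor C D F" and G: "is_functor D C G"
    and \<sigma>: "nat_trans C C id_functor (comp_functor G F) \<sigma>" "\<forall>a \<in> Obj C. iso_arr C (\<sigma> a)"
    and \<tau>: "nat_trans D D (comp_functor F G) id_functor \<tau>" "\<forall>a \<in> Obj D. iso_arr D (\<tau> a)"
    unfolding equivalence_functor_def nat_iso_def by blast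
  interpret F: is_functor C D F by (rule F)
  interpret G: is_functor D C G by (rule G)
  interpret \<sigma>: nat_trans C C id_functor "comp_functor G F" \<sigma> by (rule \<sigma>)
  interpret \<tau>: nat_trans D D "comp_functor F G" id_functor \<tau> by (rule \<tau>)
  have iso: "iso_arr C (\<sigma> x)" "iso_arr C (\<sigma> y)"
    using \<sigma> assms by auto
  have comp [simp]: "\<sigma> z \<in> Arr C" "Dom C (\<sigma> z) = z" "Cod C (\<sigma> z) = omap G (omap F z)"
    if "z \<in> Obj C" for z
    using \<sigma>.component[OF that] by (auto simp: Hom_def id_functor_def comp_functor_def)
  have [simp]: "g \<in> Arr D" "Dom D g = omap F x" "Cod D g = omap F y"
    using assms(4) by (auto simp: Hom_def)
  define h where "h = inv_arr C (\<sigma> y) \<cdot>\<^bsub>C\<^esub> (amap G g \<cdot>\<^bsub>C\<^esub> \<sigma> x)"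
  have h: "h \<in> Hom C x y"
    using assms iso by (auto simp: h_def Hom_def)
  have "amap G (amap F h) \<cdot>\<^bsub>C\<^esub> \<sigma> x = \<sigma> y \<cdot>\<^bsub>C\<^esub> h"
    using \<sigma>.naturality[OF h] by (simp add: id_functor_def comp_functor_def)
  also have "\<dots> = amap G g \<cdot>\<^bsub>C\<^esub> \<sigma> x"
    using assms iso by (simp add: h_def)
  finally have "amap G (amap F h) = amap G g"
    by (rule F.C.iso_arr_cancel_right[where h = "\<sigma> x"]) (use h assms iso in \<open>auto simp: Hom_def\<close>)
  moreover have "\<tau> (omap F y) \<cdot>\<^bsub>D\<^esub> amap F (amap G k) = k \<cdot>\<^bsub>D\<^esub> \<tau> (omap F x)"
    if "k \<in> Hom D (omap F x) (omap F y)" for k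
    using \<tau>.naturality[OF that] by (simp add: id_functor_def comp_functor_def)
  ultimately have "amap F h \<cdot>\<^bsub>D\<^esub> \<tau> (omap F x) = g \<cdot>\<^bsub>D\<^esub> \<tau> (omap F x)"
    using F.amap_Hom[OF h] assms(4) by metis
  then have "amap F h = g"
    by (rule F.D.iso_arr_cancel_right[where h = "\<tau> (omap F x)"])
      (use h assms \<tau>(2) \<tau>.component[of "omap F x"] in \<open>auto simp: Hom_def id_functor_def\<close>)
  with h show ?thesis by blast
qed

lemma equivalence_functor_essentially_surjective:
  assumes "equivalence_functor C D F" "d \<in> Obj D"
  shows "\<exists>x \<in> Obj C. \<exists>g \<in> Hom D (omap F x) d. iso_arr D g"
proof -
  from assms obtain G \<tau> where F: "is_functor C D F" and G: "is_functor D C G"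
    and \<tau>: "nat_trans D D (comp_functor F G) id_functor \<tau>" "\<forall>a \<in> Obj D. iso_arr D (\<tau> a)"
    unfolding equivalence_functor_def nat_iso_def by blast
  interpret G: is_functor D C G by (rule G)
  interpret \<tau>: nat_trans D D "comp_functor F G" id_functor \<tau> by (rule \<tau>)
  show ?thesis
    using \<tau>(2) \<tau>.component[OF assms(2)] assms(2)
    by (auto simp: id_functor_def comp_functor_def intro!: bexI[of _ "omap G d"] bexI[of _ "\<tau> d"])
qed

section \<open>Subobjects and coalgebra structures under a comonadic functor\<close>

context adjoint_functors
begin

lemma unit_arr [simp]:
  assumes "x \<in> Obj C"
  shows "\<eta> x \<in> Arr C" "Dom C (\<eta> x) = x" "Cod C (\<eta> x) = omap U (omap F x)"
  using unit.component[OF assms] by (auto simp: Hom_def id_functor_def comp_functor_def)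

lemma counit_arr [simp]:
  assumes "d \<in> Obj D"
  shows "\<epsilon> d \<in> Arr D" "Dom D (\<epsilon> d) = omap F (omap U d)" "Cod D (\<epsilon> d) = d"
  using counit.component[OF assms] by (auto simp: Hom_def id_functor_def comp_functor_def)

lemma unit_natural:
  "h \<in> Arr C \<Longrightarrow> \<eta> (Cod C h) \<cdot>\<^bsub>C\<^esub> h = amap U (amap F h) \<cdot>\<^bsub>C\<^esub> \<eta> (Dom C h)"
  using unit.naturality[of h "Dom C h" "Cod C h"]
  by (auto simp: Hom_def id_functor_def comp_functor_def)

lemma counit_natural:
  "g \<in> Arr D \<Longrightarrow> \<epsilon> (Cod D g) \<cdot>\<^bsub>D\<^esub> amap F (amap U g) = g \<cdot>\<^bsub>D\<^esub> \<epsilon> (Dom D g)"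
  using counit.naturality[of g "Dom D g" "Cod D g"]
  by (auto simp: Hom_def id_functor_def comp_functor_def)

text \<open>The transpose of \<open>i : x \<rightarrow> U d\<close>.\<close>

definition sharp :: "'p \<Rightarrow> 'm \<Rightarrow> 'q" where
  "sharp d i = \<epsilon> d \<cdot>\<^bsub>D\<^esub> amap F i"

lemma sharp_arr [simp]:
  assumes "d \<in> Obj D" "i \<in> Arr C" "Cod C i = omap U d"
  shows "sharp d i \<in> Arr D" "Dom D (sharp d i) = omap F (Dom C i)" "Cod D (sharp d i) = d"
  using assms by (auto simp: sharp_def)

lemma flat_sharp:
  assumes "d \<in> Obj D" "i \<in> Arr C" "Cod C i = omap U d"
  shows "amap U (sharp d i) \<cdot>\<^bsub>C\<^esub> \<eta> (Dom C i) = i"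
proof -
  have "amap U (sharp d i) \<cdot>\<^bsub>C\<^esub> \<eta> (Dom C i) =
      amap U (\<epsilon> d) \<cdot>\<^bsub>C\<^esub> (\<eta> (omap U d) \<cdot>\<^bsub>C\<^esub> i)"
    using assms unit_natural[of i] by (simp add: sharp_def F.C.comp_assoc)
  also have "\<dots> = i"
    using assms triangle_U[of d] F.C.comp_assoc[of i "\<eta> (omap U d)" "amap U (\<epsilon> d)"] by simp
  finally show ?thesis .
qed

lemma sharp_flat:
  assumes "x \<in> Obj C" "g \<in> Arr D" "Dom D g = omap F x"
  shows "sharp (Cod D g) (amap U g \<cdot>\<^bsub>C\<^esub> \<eta> x) = g"
proof -
  have "sharp (Cod D g) (amap U g \<cdot>\<^bsub>C\<^esub> \<eta> x) =
      (\<epsilon> (Cod D g) \<cdot>\<^bsub>D\<^esub> amap F (amap U g)) \<cdot>\<^bsub>D\<^esub> amap F (\<eta> x)"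
    using assms by (simp add: sharp_def F.D.comp_assoc)
  also have "\<dots> = g"
    using assms counit_natural[of g] triangle_F[of x] by (simp add: F.D.comp_assoc)
  finally show ?thesis .
qed

lemma sharp_comp:
  assumes "d \<in> Obj D" "i \<in> Arr C" "Cod C i = omap U d" "h \<in> Arr C" "Cod C h = Dom C i"
  shows "sharp d (i \<cdot>\<^bsub>C\<^esub> h) = sharp d i \<cdot>\<^bsub>D\<^esub> amap F h"
  using assms by (simp add: sharp_def F.D.comp_assoc)

lemma U_faithful_on_F:
  assumes "amap U g = amap U h" "x \<in> Obj C" "g \<in> Arr D" "h \<in> Arr D" "Dom D g = omap F x"
    "Dom D h = omap F x" "Cod D g = Cod D h"
  shows "g = h"
  using sharp_flat[of x g] sharp_flat[of x h] assms by metis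

text \<open>The right adjoint need not reflect isomorphisms, but it does on arrows from an object F x
  to an object on which the counit splits: the inverse of \<open>U g\<close>, transposed along the
  splitting s, is a right inverse of g, and it is a left inverse because U is faithful
  on arrows out of objects F x.\<close>

lemma U_reflects_iso_to_split:
  assumes "x \<in> Obj C" "g \<in> Arr D" "Dom D g = omap F x" "Cod D g = d"
    and s: "s \<in> Arr D" "Dom D s = d" "Cod D s = omap F (omap U d)"
      "\<epsilon> d \<cdot>\<^bsub>D\<^esub> s = ident D d"
    and iso: "iso_arr C (amap U g)"
  shows "iso_arr D g"
proof -
  note [simp] = assms(1-4) s(1-3)
  have [simp]: "d \<in> Obj D"
    using F.D.Cod_Obj[of g] by simp
  define \<gamma> where "\<gamma> = inv_arr C (amap U g)"
  have \<gamma> [simp]: "\<gamma> \<in> Arr C" "Dom C \<gamma> = omap U d" "Cod C \<gamma> = omap U (omap F x)"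
    using iso by (auto simp: \<gamma>_def)
  define r where "r = sharp (omap F x) \<gamma> \<cdot>\<^bsub>D\<^esub> s"
  have r [simp]: "r \<in> Arr D" "Dom D r = d" "Cod D r = omap F x"
    by (auto simp: r_def)
  \<comment> \<open>The composite of g with the transpose of \<open>\<gamma>\<close> is the counit at d, which s splits.\<close>
  have "g \<cdot>\<^bsub>D\<^esub> sharp (omap F x) \<gamma> = (g \<cdot>\<^bsub>D\<^esub> \<epsilon> (omap F x)) \<cdot>\<^bsub>D\<^esub> amap F \<gamma>"
    by (simp add: sharp_def F.D.comp_assoc)
  also have "\<dots> = (\<epsilon> d \<cdot>\<^bsub>D\<^esub> amap F (amap U g)) \<cdot>\<^bsub>D\<^esub> amap F \<gamma>"
    using counit_natural[of g] by simp
  also have "\<dots> = \<epsilon> d \<cdot>\<^bsub>D\<^esub> amap F (amap U g \<cdot>\<^bsub>C\<^esub> \<gamma>)"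
    using iso by (simp add: F.D.comp_assoc)
  also have "\<dots> = \<epsilon> d"
    using iso by (simp add: \<gamma>_def)
  finally have gr: "g \<cdot>\<^bsub>D\<^esub> r = ident D d"
    using s by (simp add: r_def flip: F.D.comp_assoc)
  have "amap U g \<cdot>\<^bsub>C\<^esub> amap U r = amap U g \<cdot>\<^bsub>C\<^esub> \<gamma>"
    using gr iso by (simp add: \<gamma>_def flip: U.amap_comp)
  then have "amap U r = \<gamma>"
    by (rule F.C.iso_arr_cancel_left[where h = "amap U g"]) (use iso in auto)
  then have "amap U (r \<cdot>\<^bsub>D\<^esub> g) = amap U (ident D (omap F x))"
    using iso by (simp add: \<gamma>_def)
  then have "r \<cdot>\<^bsub>D\<^esub> g = ident D (omap F x)"
    by (rule U_faithful_on_F[where x = x]) auto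
  with gr show ?thesis
    by (intro F.D.iso_arrI(1)[of g r]) auto
qed

text \<open>The coalgebra structure that an arrow i into \<open>U d\<close> induces on d, if its transpose is
  invertible: it is transported along the transpose from the coalgebra that the
  comparison functor assigns to the domain of i.\<close>

definition induces :: "'m \<Rightarrow> 'p \<Rightarrow> 'q \<Rightarrow> bool" where
  "induces i d \<theta> \<longleftrightarrow> i \<in> Arr C \<and> Cod C i = omap U d \<and> iso_arr D (sharp d i) \<and>
     \<theta> \<in> Hom D d (omap F (omap U d)) \<and> amap F i = \<theta> \<cdot>\<^bsub>D\<^esub> sharp d i"

abbreviation comonad_comult :: "'p \<Rightarrow> 'q" where
  "comonad_comult d \<equiv> amap F (\<eta> (omap U d))"

abbreviation coalgebra_structures :: "'p \<Rightarrow> 'q set" where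
  "coalgebra_structures d \<equiv>
     {\<theta>. (d, \<theta>) \<in> coalgebras D (comp_functor F U) \<epsilon> comonad_comult}"

text \<open>The transpose is a coalgebra morphism from the value of the comparison functor to
  the induced coalgebra: both sides are the image under F of
  the arrow i itself.\<close>

lemma induces_coalgebra_map:
  assumes "d \<in> Obj D" "induces i d \<theta>"
  shows "amap F (amap U (sharp d i)) \<cdot>\<^bsub>D\<^esub> amap F (\<eta> (Dom C i)) = \<theta> \<cdot>\<^bsub>D\<^esub> sharp d i"
  using assms flat_sharp[of d i] by (auto simp: induces_def simp flip: F.amap_comp)

lemma induced_structure_exists:
  assumes "d \<in> Obj D" "i \<in> Arr C" "Cod C i = omap U d" "iso_arr D (sharp d i)"
  shows "\<exists>\<theta>. induces i d \<theta>"
  using assms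
  by (intro exI[of _ "amap F i \<cdot>\<^bsub>D\<^esub> inv_arr D (sharp d i)"])
     (auto simp: induces_def Hom_def F.D.comp_assoc)

text \<open>Both laws may be checked after precomposition with the invertible transpose. There the
  counit law is the definition of the transpose, and coassociativity is the naturality of the unit
  at i.\<close>

lemma induced_structure_is_coalgebra:
  assumes d: "d \<in> Obj D" and "induces i d \<theta>"
  shows "\<theta> \<in> coalgebra_structures d"
proof -
  define \<beta> where "\<beta> = sharp d i"
  have i [simp]: "i \<in> Arr C" "Cod C i = omap U d" and iso: "iso_arr D \<beta>"
    and \<theta> [simp]: "\<theta> \<in> Arr D" "Dom D \<theta> = d" "Cod D \<theta> = omap F (omap U d)"
    and F: "amap F i = \<theta> \<cdot>\<^bsub>D\<^esub> \<beta>"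
    using assms by (auto simp: induces_def Hom_def \<beta>_def)
  have \<beta> [simp]: "\<beta> \<in> Arr D" "Dom D \<beta> = omap F (Dom C i)" "Cod D \<beta> = d"
    using d by (simp_all add: \<beta>_def)
  note [simp] = d
  have "(\<epsilon> d \<cdot>\<^bsub>D\<^esub> \<theta>) \<cdot>\<^bsub>D\<^esub> \<beta> = ident D d \<cdot>\<^bsub>D\<^esub> \<beta>"
    using F by (simp add: F.D.comp_assoc) (simp add: \<beta>_def sharp_def)
  then have counit: "\<epsilon> d \<cdot>\<^bsub>D\<^esub> \<theta> = ident D d"
    by (rule F.D.iso_arr_cancel_right[where h = \<beta>]) (use iso in auto)
  have "amap F (amap U \<theta>) \<cdot>\<^bsub>D\<^esub> (\<theta> \<cdot>\<^bsub>D\<^esub> \<beta>) =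
      amap F (amap U \<theta>) \<cdot>\<^bsub>D\<^esub> (amap F (amap U \<beta>) \<cdot>\<^bsub>D\<^esub> amap F (\<eta> (Dom C i)))"
    using induces_coalgebra_map[OF assms] by (simp add: \<beta>_def)
  also have "\<dots> = amap F (amap U (\<theta> \<cdot>\<^bsub>D\<^esub> \<beta>)) \<cdot>\<^bsub>D\<^esub> amap F (\<eta> (Dom C i))"
    by (simp add: F.D.comp_assoc)
  also have "\<dots> = amap F (amap U (amap F i) \<cdot>\<^bsub>C\<^esub> \<eta> (Dom C i))"
    by (simp flip: F)
  also have "\<dots> = amap F (\<eta> (omap U d) \<cdot>\<^bsub>C\<^esub> i)"
    using unit_natural[of i] by simp
  also have "\<dots> = comonad_comult d \<cdot>\<^bsub>D\<^esub> (\<theta> \<cdot>\<^bsub>D\<^esub> \<beta>)"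
    using F by simp
  finally have "(amap F (amap U \<theta>) \<cdot>\<^bsub>D\<^esub> \<theta>) \<cdot>\<^bsub>D\<^esub> \<beta> = (comonad_comult d \<cdot>\<^bsub>D\<^esub> \<theta>) \<cdot>\<^bsub>D\<^esub> \<beta>"
    by (simp add: F.D.comp_assoc)
  then have "amap F (amap U \<theta>) \<cdot>\<^bsub>D\<^esub> \<theta> = comonad_comult d \<cdot>\<^bsub>D\<^esub> \<theta>"
    by (rule F.D.iso_arr_cancel_right[where h = \<beta>]) (use iso in auto)
  with counit show ?thesis
    by (auto simp: coalgebras_def comp_functor_def Hom_def)
qed

end

locale comonadic_adjunction = adjoint_functors +
  assumes comparison_equivalence:
    "equivalence_functor C (Coalg D (comp_functor F U) \<epsilon> (\<lambda>d. amap F (\<eta> (omap U d))))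
       (comparison F \<eta> C)"
begin

lemma F_faithful:
  assumes "amap F g = amap F h" "g \<in> Arr C" "h \<in> Arr C" "Dom C g = Dom C h" "Cod C g = Cod C h"
  shows "g = h"
  using equivalence_functor_faithful[OF comparison_equivalence, of g "Dom C h" "Cod C h" h] assms
  by (auto simp: Hom_def comparison_def)

text \<open>Since the transpose of \<open>i g\<close> is that of i after \<open>F g\<close>, an arrow with
  invertible transpose can be cancelled because F is faithful.\<close>

lemma iso_sharp_monic:
  assumes "d \<in> Obj D" "i \<in> Arr C" "Cod C i = omap U d" "iso_arr D (sharp d i)"
  shows "monic C i"
  unfolding monic_def
proof (intro conjI allI ballI impI)
  fix x g h assume gh: "g \<in> Hom C x (Dom C i)" "h \<in> Hom C x (Dom C i)" "i \<cdot>\<^bsub>C\<^esub> g = i \<cdot>\<^bsub>C\<^esub> h"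
  then have "sharp d i \<cdot>\<^bsub>D\<^esub> amap F g = sharp d i \<cdot>\<^bsub>D\<^esub> amap F h"
    using assms sharp_comp[of d i] by (metis (mono_tags, lifting) Hom_def mem_Collect_eq)
  then have "amap F g = amap F h"
    by (rule F.D.iso_arr_cancel_left[where h = "sharp d i"])
      (use assms gh in \<open>auto simp: Hom_def\<close>)
  then show "g = h"
    by (rule F_faithful) (use gh in \<open>auto simp: Hom_def\<close>)
qed (use assms in auto)

text \<open>Fullness of the comparison functor lifts the coalgebra isomorphism between the values at
  the two domains to a factorisation of one arrow through the other.\<close>

lemma induces_same_factors:
  assumes d: "d \<in> Obj D" and i: "induces i d \<theta>" and j: "induces j d \<theta>"
  shows "\<exists>h \<in> Hom C (Dom C i) (Dom C j). j \<cdot>\<^bsub>C\<^esub> h = i"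
proof -
  define \<beta> where "\<beta> = sharp d i"
  define \<gamma> where "\<gamma> = sharp d j"
  let ?x = "Dom C i" and ?y = "Dom C j"
  have [simp]: "i \<in> Arr C" "Cod C i = omap U d" "j \<in> Arr C" "Cod C j = omap U d"
    "iso_arr D \<beta>" "iso_arr D \<gamma>" "\<theta> \<in> Arr D" "Dom D \<theta> = d" "Cod D \<theta> = omap F (omap U d)"
    using i j by (auto simp: induces_def Hom_def \<beta>_def \<gamma>_def)
  have [simp]: "\<beta> \<in> Arr D" "Dom D \<beta> = omap F ?x" "Cod D \<beta> = d"
    "\<gamma> \<in> Arr D" "Dom D \<gamma> = omap F ?y" "Cod D \<gamma> = d"
    using d by (simp_all add: \<beta>_def \<gamma>_def)
  define g where "g = inv_arr D \<gamma> \<cdot>\<^bsub>D\<^esub> \<beta>"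
  have [simp]: "g \<in> Arr D" "Dom D g = omap F ?x" "Cod D g = omap F ?y"
    by (auto simp: g_def)
  have \<gamma>g: "\<gamma> \<cdot>\<^bsub>D\<^esub> g = \<beta>"
    by (simp add: g_def)
  \<comment> \<open>Since \<open>\<beta>\<close> and \<open>\<gamma>\<close> are coalgebra morphisms onto the same coalgebra, so is g.\<close>
  have "amap F (amap U \<gamma>) \<cdot>\<^bsub>D\<^esub> (amap F (amap U g) \<cdot>\<^bsub>D\<^esub> amap F (\<eta> ?x)) =
      amap F (amap U (\<gamma> \<cdot>\<^bsub>D\<^esub> g)) \<cdot>\<^bsub>D\<^esub> amap F (\<eta> ?x)"
    by (simp add: F.D.comp_assoc)
  also have "\<dots> = \<theta> \<cdot>\<^bsub>D\<^esub> \<beta>"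
    using induces_coalgebra_map[OF d i] by (simp only: \<gamma>g flip: \<beta>_def)
  also have "\<dots> = (\<theta> \<cdot>\<^bsub>D\<^esub> \<gamma>) \<cdot>\<^bsub>D\<^esub> g"
    using \<gamma>g by (simp add: F.D.comp_assoc)
  also have "\<dots> = (amap F (amap U \<gamma>) \<cdot>\<^bsub>D\<^esub> amap F (\<eta> ?y)) \<cdot>\<^bsub>D\<^esub> g"
    using induces_coalgebra_map[OF d j] by (simp only: flip: \<gamma>_def)
  also have "\<dots> = amap F (amap U \<gamma>) \<cdot>\<^bsub>D\<^esub> (amap F (\<eta> ?y) \<cdot>\<^bsub>D\<^esub> g)"
    by (simp add: F.D.comp_assoc)
  finally have g_map: "amap F (amap U g) \<cdot>\<^bsub>D\<^esub> amap F (\<eta> ?x) = amap F (\<eta> ?y) \<cdot>\<^bsub>D\<^esub> g"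
    by (rule F.D.iso_arr_cancel_left[where h = "amap F (amap U \<gamma>)"])
       (use F.preserves_iso[OF U.preserves_iso[of \<gamma>]] in auto)
  let ?X = "(omap F ?x, amap F (\<eta> ?x))" and ?Y = "(omap F ?y, amap F (\<eta> ?y))"
  let ?T = "Coalg D (comp_functor F U) \<epsilon> (\<lambda>d. amap F (\<eta> (omap U d)))"
  interpret K: is_functor C ?T "comparison F \<eta> C"
    using comparison_equivalence by (simp add: equivalence_functor_def)
  have "?X \<in> Obj ?T" "?Y \<in> Obj ?T"
    using K.omap_Obj[of ?x] K.omap_Obj[of ?y] by (auto simp: comparison_def)
  with g_map have "(?X, g, ?Y) \<in> Hom ?T (omap (comparison F \<eta> C) ?x) (omap (comparison F \<eta> C) ?y)"
    by (auto simp: Coalg_def Hom_def comparison_def comp_functor_def)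
  then obtain h where h: "h \<in> Hom C ?x ?y" "amap (comparison F \<eta> C) h = (?X, g, ?Y)"
    using equivalence_functor_full[OF comparison_equivalence, of ?x ?y] by force
  then have [simp]: "h \<in> Arr C" "Dom C h = ?x" "Cod C h = ?y" "amap F h = g"
    by (simp_all add: comparison_def Hom_def)
  have "sharp d (j \<cdot>\<^bsub>C\<^esub> h) = sharp d i"
    using d \<gamma>g by (simp add: sharp_comp flip: \<beta>_def \<gamma>_def)
  moreover have "j \<cdot>\<^bsub>C\<^esub> h \<in> Arr C" "Dom C (j \<cdot>\<^bsub>C\<^esub> h) = ?x" "Cod C (j \<cdot>\<^bsub>C\<^esub> h) = omap U d"
    by simp_all
  ultimately have "j \<cdot>\<^bsub>C\<^esub> h = i"
    using flat_sharp[OF d, of i] flat_sharp[OF d, of "j \<cdot>\<^bsub>C\<^esub> h"] \<open>i \<in> Arr C\<close> \<open>Cod C i = omap U d\<close>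
    by metis
  with h show ?thesis by blast
qed

text \<open>So a coalgebra structure determines the subobject that induces it.\<close>

lemma induces_same_subobject:
  assumes d: "d \<in> Obj D" and i: "induces i d \<theta>" and j: "induces j d \<theta>"
  shows "subobject C i = subobject C j"
proof -
  have ij: "i \<in> Arr C" "Cod C i = omap U d" "iso_arr D (sharp d i)"
    "j \<in> Arr C" "Cod C j = omap U d" "iso_arr D (sharp d j)"
    using i j by (auto simp: induces_def)
  obtain h k where "h \<in> Hom C (Dom C i) (Dom C j)" "j \<cdot>\<^bsub>C\<^esub> h = i"
    "k \<in> Hom C (Dom C j) (Dom C i)" "i \<cdot>\<^bsub>C\<^esub> k = j"
    using induces_same_factors[OF d i j] induces_same_factors[OF d j i] by blast
  then show ?thesis
    using d ij by (intro F.C.subobject_eqI[of i j k h] iso_sharp_monic[of d]) (auto simp: Hom_def)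
qed

text \<open>Essential surjectivity of the comparison functor provides an isomorphism onto the
  given coalgebra from one of its values; its transpose is the arrow sought.\<close>

lemma coalgebra_structure_induced:
  assumes d: "d \<in> Obj D" and \<theta>: "\<theta> \<in> coalgebra_structures d"
  shows "\<exists>i. induces i d \<theta>"
proof -
  let ?T = "Coalg D (comp_functor F U) \<epsilon> (\<lambda>d. amap F (\<eta> (omap U d)))"
  interpret K: is_functor C ?T "comparison F \<eta> C"
    using comparison_equivalence by (simp add: equivalence_functor_def)
  have "(d, \<theta>) \<in> Obj ?T"
    using \<theta> by (simp add: Coalg_def)
  then obtain x g where x: "x \<in> Obj C" and g: "g \<in> Hom ?T (omap (comparison F \<eta> C) x) (d, \<theta>)"
    and iso: "iso_arr ?T g"
    using equivalence_functor_essentially_surjective[OF comparison_equivalence] by metis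
  define X where "X = (omap F x, amap F (\<eta> x))"
  from g obtain \<beta> where g_eq: "g = (X, \<beta>, (d, \<theta>))"
    and \<beta>: "\<beta> \<in> Arr D" "Dom D \<beta> = omap F x" "Cod D \<beta> = d"
    and map: "amap F (amap U \<beta>) \<cdot>\<^bsub>D\<^esub> amap F (\<eta> x) = \<theta> \<cdot>\<^bsub>D\<^esub> \<beta>"
    by (auto simp: Coalg_def Hom_def comparison_def comp_functor_def X_def)
  obtain k where "inverse_arrows ?T g k"
    using iso by (auto simp: iso_arr_def)
  then have "iso_arr D \<beta>"
    using g_eq \<beta> by (auto simp: inverse_arrows_def Coalg_def Hom_def X_def
        intro!: F.D.iso_arrI(1)[of \<beta> "fst (snd k)"])
  moreover define i where "i = amap U \<beta> \<cdot>\<^bsub>C\<^esub> \<eta> x"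
  moreover have "sharp d i = \<beta>"
    using sharp_flat[OF x \<beta>(1,2)] \<beta> by (simp add: i_def)
  moreover have "\<theta> \<in> Hom D d (omap F (omap U d))"
    using \<theta> by (auto simp: coalgebras_def comp_functor_def)
  ultimately have "induces i d \<theta>"
    using x \<beta> map by (auto simp: induces_def)
  then show ?thesis ..
qed

end


section \<open>Coherence in a bicategory\<close>

context bicategory
begin

lemma src_trg_cod [simp]:
  assumes "\<alpha> \<in> Arr B"
  shows "Src B (Cod B \<alpha>) = Src B (Dom B \<alpha>)" "Trg B (Cod B \<alpha>) = Trg B (Dom B \<alpha>)"
  using Src_parallel[of \<alpha> "Dom B \<alpha>" "Cod B \<alpha>"] Trg_parallel[of \<alpha> "Dom B \<alpha>" "Cod B \<alpha>"] assms
  by (auto simp: Hom_def)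

lemma one_cell [simp]:
  assumes "x \<in> Cells0 B"
  shows "One B x \<in> Obj B" "Src B (One B x) = x" "Trg B (One B x) = x"
  using One_cell[OF assms] by auto

lemma src_trg_cells [simp]:
  assumes "f \<in> Obj B"
  shows "Src B f \<in> Cells0 B" "Trg B f \<in> Cells0 B"
  using assms Src_Cells0 Trg_Cells0 by auto

lemma hcomp_cell [simp]:
  assumes "f \<in> Obj B" "g \<in> Obj B" "Trg B f = Src B g"
  shows "g \<star> f \<in> Obj B" "Src B (g \<star> f) = Src B f" "Trg B (g \<star> f) = Trg B g"
  using HComp1_cell[OF assms] by auto

lemma hcomp_arr [simp]:
  assumes "\<alpha> \<in> Arr B" "\<beta> \<in> Arr B" "Trg B (Dom B \<alpha>) = Src B (Dom B \<beta>)"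
  shows "\<beta> \<odot> \<alpha> \<in> Arr B" "Dom B (\<beta> \<odot> \<alpha>) = Dom B \<beta> \<star> Dom B \<alpha>"
    "Cod B (\<beta> \<odot> \<alpha>) = Cod B \<beta> \<star> Cod B \<alpha>"
  using HComp2_Hom[of \<alpha> "Dom B \<alpha>" "Cod B \<alpha>" \<beta> "Dom B \<beta>" "Cod B \<beta>"] assms
  by (auto simp: Hom_def)

lemmas hcomp_ident [simp] = HComp2_ident

lemma assoc_arr [simp]:
  assumes "f \<in> Obj B" "g \<in> Obj B" "h \<in> Obj B" "Trg B f = Src B g" "Trg B g = Src B h"
  shows "iso_arr B (Assoc B h g f)" "Assoc B h g f \<in> Arr B"
    "Dom B (Assoc B h g f) = (h \<star> g) \<star> f" "Cod B (Assoc B h g f) = h \<star> (g \<star> f)"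
  using Assoc_iso[OF assms] by (auto simp: Hom_def)

lemma lunit_arr [simp]:
  assumes "f \<in> Obj B"
  shows "iso_arr B (Lunit B f)" "Lunit B f \<in> Arr B"
    "Dom B (Lunit B f) = One B (Trg B f) \<star> f" "Cod B (Lunit B f) = f"
  using Lunit_iso[OF assms] by (auto simp: Hom_def)

lemma runit_arr [simp]:
  assumes "f \<in> Obj B"
  shows "iso_arr B (Runit B f)" "Runit B f \<in> Arr B"
    "Dom B (Runit B f) = f \<star> One B (Src B f)" "Cod B (Runit B f) = f"
  using Runit_iso[OF assms] by (auto simp: Hom_def)

lemma interchange_arr:
  assumes "\<alpha> \<in> Arr B" "\<alpha>' \<in> Arr B" "\<beta> \<in> Arr B" "\<beta>' \<in> Arr B" "Cod B \<alpha> = Dom B \<alpha>'"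
    "Cod B \<beta> = Dom B \<beta>'" "Trg B (Dom B \<alpha>) = Src B (Dom B \<beta>)"
  shows "(\<beta>' \<odot> \<alpha>') \<cdot> (\<beta> \<odot> \<alpha>) = (\<beta>' \<cdot> \<beta>) \<odot> (\<alpha>' \<cdot> \<alpha>)"
  using interchange[of \<alpha> "Dom B \<alpha>" "Dom B \<alpha>'" \<alpha>' "Cod B \<alpha>'" \<beta> "Dom B \<beta>" "Dom B \<beta>'" \<beta>' "Cod B \<beta>'"]
    assms by (auto simp: Hom_def)

lemma whisker_left_comp:
  assumes "g \<in> Obj B" "\<alpha> \<in> Arr B" "\<beta> \<in> Arr B" "Cod B \<alpha> = Dom B \<beta>" "Trg B (Dom B \<alpha>) = Src B g"
  shows "ident B g \<odot> (\<beta> \<cdot> \<alpha>) = (ident B g \<odot> \<beta>) \<cdot> (ident B g \<odot> \<alpha>)"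
  using assms by (simp add: interchange_arr)

lemma whisker_right_comp:
  assumes "g \<in> Obj B" "\<alpha> \<in> Arr B" "\<beta> \<in> Arr B" "Cod B \<alpha> = Dom B \<beta>" "Trg B g = Src B (Dom B \<alpha>)"
  shows "(\<beta> \<cdot> \<alpha>) \<odot> ident B g = (\<beta> \<odot> ident B g) \<cdot> (\<alpha> \<odot> ident B g)"
  using assms by (simp add: interchange_arr)

lemma assoc_natural:
  assumes "\<alpha> \<in> Arr B" "\<beta> \<in> Arr B" "\<gamma> \<in> Arr B" "Trg B (Dom B \<alpha>) = Src B (Dom B \<beta>)"
    "Trg B (Dom B \<beta>) = Src B (Dom B \<gamma>)"
  shows "Assoc B (Cod B \<gamma>) (Cod B \<beta>) (Cod B \<alpha>) \<cdot> ((\<gamma> \<odot> \<beta>) \<odot> \<alpha>) =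
    (\<gamma> \<odot> (\<beta> \<odot> \<alpha>)) \<cdot> Assoc B (Dom B \<gamma>) (Dom B \<beta>) (Dom B \<alpha>)"
  using Assoc_natural[of \<alpha> "Dom B \<alpha>" "Cod B \<alpha>" \<beta> "Dom B \<beta>" "Cod B \<beta>" \<gamma> "Dom B \<gamma>" "Cod B \<gamma>"] assms
  by (auto simp: Hom_def)

lemma lunit_natural:
  "\<alpha> \<in> Arr B \<Longrightarrow> Lunit B (Cod B \<alpha>) \<cdot> (ident B (One B (Trg B (Dom B \<alpha>))) \<odot> \<alpha>) =
    \<alpha> \<cdot> Lunit B (Dom B \<alpha>)"
  using Lunit_natural[of \<alpha> "Dom B \<alpha>" "Cod B \<alpha>"] by (auto simp: Hom_def)

lemma assoc_inv_natural:
  assumes "\<alpha> \<in> Arr B" "\<beta> \<in> Arr B" "\<gamma> \<in> Arr B" "Trg B (Dom B \<alpha>) = Src B (Dom B \<beta>)"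
    "Trg B (Dom B \<beta>) = Src B (Dom B \<gamma>)"
  shows "inv_arr B (Assoc B (Cod B \<gamma>) (Cod B \<beta>) (Cod B \<alpha>)) \<cdot> (\<gamma> \<odot> (\<beta> \<odot> \<alpha>)) =
    ((\<gamma> \<odot> \<beta>) \<odot> \<alpha>) \<cdot> inv_arr B (Assoc B (Dom B \<gamma>) (Dom B \<beta>) (Dom B \<alpha>))"
  using assoc_natural[OF assms] by (rule iso_arr_square) (use assms in auto)

lemma lunit_inv_natural:
  "\<alpha> \<in> Arr B \<Longrightarrow> inv_arr B (Lunit B (Cod B \<alpha>)) \<cdot> \<alpha> =
    (ident B (One B (Trg B (Dom B \<alpha>))) \<odot> \<alpha>) \<cdot> inv_arr B (Lunit B (Dom B \<alpha>))"
  using lunit_natural by (rule iso_arr_square) auto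

lemma pentagon':
  assumes "f \<in> Obj B" "g \<in> Obj B" "h \<in> Obj B" "k \<in> Obj B"
    "Trg B f = Src B g" "Trg B g = Src B h" "Trg B h = Src B k"
  shows "(ident B k \<odot> Assoc B h g f) \<cdot> (Assoc B k (h \<star> g) f \<cdot> (Assoc B k h g \<odot> ident B f)) =
    Assoc B k h (g \<star> f) \<cdot> Assoc B (k \<star> h) g f"
  using pentagon[OF assms] assms by (simp add: comp_assoc)

lemma hcomp_iso:
  assumes "iso_arr B \<alpha>" "iso_arr B \<beta>" "Trg B (Dom B \<alpha>) = Src B (Dom B \<beta>)"
  shows "iso_arr B (\<beta> \<odot> \<alpha>)" "inv_arr B (\<beta> \<odot> \<alpha>) = inv_arr B \<beta> \<odot> inv_arr B \<alpha>"
proof -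
  have "\<alpha> \<in> Arr B" "\<beta> \<in> Arr B"
    using assms iso_arr_arr by auto
  then have "\<beta> \<odot> \<alpha> \<in> Arr B" "inv_arr B \<beta> \<odot> inv_arr B \<alpha> \<in> Arr B"
    "Dom B (inv_arr B \<beta> \<odot> inv_arr B \<alpha>) = Cod B (\<beta> \<odot> \<alpha>)"
    "Cod B (inv_arr B \<beta> \<odot> inv_arr B \<alpha>) = Dom B (\<beta> \<odot> \<alpha>)"
    "(inv_arr B \<beta> \<odot> inv_arr B \<alpha>) \<cdot> (\<beta> \<odot> \<alpha>) = ident B (Dom B (\<beta> \<odot> \<alpha>))"
    "(\<beta> \<odot> \<alpha>) \<cdot> (inv_arr B \<beta> \<odot> inv_arr B \<alpha>) = ident B (Cod B (\<beta> \<odot> \<alpha>))"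
    using assms by (simp_all add: interchange_arr)
  then show "iso_arr B (\<beta> \<odot> \<alpha>)" "inv_arr B (\<beta> \<odot> \<alpha>) = inv_arr B \<beta> \<odot> inv_arr B \<alpha>"
    using iso_arrI by blast+
qed

text \<open>Whiskering with a unit 1-cell is naturally isomorphic to the identity, hence faithful.\<close>

lemma whisker_one_faithful:
  assumes "ident B (One B x) \<odot> \<alpha> = ident B (One B x) \<odot> \<beta>" "\<alpha> \<in> Arr B" "\<beta> \<in> Arr B"
    "Dom B \<alpha> = Dom B \<beta>" "Cod B \<alpha> = Cod B \<beta>" "Trg B (Dom B \<alpha>) = x"
  shows "\<alpha> = \<beta>"
proof -
  have "\<alpha> \<cdot> Lunit B (Dom B \<alpha>) = \<beta> \<cdot> Lunit B (Dom B \<alpha>)"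
    using lunit_natural[of \<alpha>] lunit_natural[of \<beta>] assms by simp
  then show ?thesis
    by (rule iso_arr_cancel_right) (use assms in auto)
qed

text \<open>Kelly's consequence of the axioms. Whiskered by a unit 1-cell on the left, both sides become
  composites in the pentagon for two unit 1-cells and are computed by the triangle.\<close>

lemma lunit_hcomp:
  assumes y: "y \<in> Obj B" and z: "z \<in> Obj B" and "Trg B z = Src B y"
  shows "Lunit B (y \<star> z) \<cdot> Assoc B (One B (Trg B y)) y z = Lunit B y \<odot> ident B z"
proof -
  let ?I = "One B (Trg B y)"
  note [simp] = assms
  let ?P = "Assoc B ?I (?I \<star> y) z \<cdot> (Assoc B ?I ?I y \<odot> ident B z)"
  have "(ident B ?I \<odot> (Lunit B (y \<star> z) \<cdot> Assoc B ?I y z)) \<cdot> ?P =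
      (ident B ?I \<odot> Lunit B (y \<star> z)) \<cdot> (Assoc B ?I ?I (y \<star> z) \<cdot> Assoc B (?I \<star> ?I) y z)"
    using pentagon'[of z y ?I ?I] by (simp add: whisker_left_comp comp_assoc)
  also have "\<dots> = (Runit B ?I \<odot> ident B (y \<star> z)) \<cdot> Assoc B (?I \<star> ?I) y z"
    using triangle[of "y \<star> z" ?I] by (simp flip: comp_assoc)
  also have "\<dots> = Assoc B ?I y z \<cdot> ((Runit B ?I \<odot> ident B y) \<odot> ident B z)"
    using assoc_natural[of "ident B z" "ident B y" "Runit B ?I"] by simp
  also have "\<dots> = Assoc B ?I y z \<cdot> (((ident B ?I \<odot> Lunit B y) \<odot> ident B z) \<cdot>
      (Assoc B ?I ?I y \<odot> ident B z))"
    using triangle[of y ?I] by (simp flip: whisker_right_comp)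
  also have "\<dots> = (ident B ?I \<odot> (Lunit B y \<odot> ident B z)) \<cdot> ?P"
    using assoc_natural[of "ident B z" "Lunit B y" "ident B ?I"] by (simp flip: comp_assoc)
  finally have "ident B ?I \<odot> (Lunit B (y \<star> z) \<cdot> Assoc B ?I y z) =
      ident B ?I \<odot> (Lunit B y \<odot> ident B z)"
    by (rule iso_arr_cancel_right) (auto intro!: iso_arr_comp hcomp_iso iso_arr_ident)
  then show ?thesis
    by (rule whisker_one_faithful) auto
qed

lemma HomCat_simps [simp]:
  "Obj (HomCat B x y) = {g \<in> Obj B. Src B g = x \<and> Trg B g = y}"
  "Arr (HomCat B x y) = {\<alpha> \<in> Arr B. Src B (Dom B \<alpha>) = x \<and> Trg B (Dom B \<alpha>) = y}"
  "Dom (HomCat B x y) = Dom B" "Cod (HomCat B x y) = Cod B" "ident (HomCat B x y) = ident B"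
  "Comp (HomCat B x y) = Comp B"
  by (simp_all add: HomCat_def)

lemma precomp_simps [simp]:
  "omap (precomp B g) x = x \<star> g" "amap (precomp B g) \<alpha> = \<alpha> \<odot> ident B g"
  by (simp_all add: precomp_def)

lemma iso_arr_HomCat [simp]:
  "iso_arr (HomCat B x y) h \<longleftrightarrow> iso_arr B h \<and> Src B (Dom B h) = x \<and> Trg B (Dom B h) = y"
proof -
  have "inverse_arrows (HomCat B x y) h k \<longleftrightarrow>
      inverse_arrows B h k \<and> Src B (Dom B h) = x \<and> Trg B (Dom B h) = y" for k
    by (auto simp: inverse_arrows_def Hom_def)
  then show ?thesis
    by (auto simp: iso_arr_def)
qed

end


section \<open>Evaluation and coevaluation of an adjunction\<close>

context adjunction
begin

lemma adj_cells [simp]: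
  "f \<in> Obj B" "fs \<in> Obj B" "Src B f = a" "Trg B f = b" "Src B fs = b" "Trg B fs = a"
  "a \<in> Cells0 B" "b \<in> Cells0 B"
  using left_cell right_cell Cells0_a Cells0_b by (auto simp: HomCat_def)

lemma adj_arr [simp]:
  "\<eta> \<in> Arr B" "Dom B \<eta> = One B a" "Cod B \<eta> = fs \<star> f"
  "\<epsilon> \<in> Arr B" "Dom B \<epsilon> = f \<star> fs" "Cod B \<epsilon> = One B b"
  using unit_cell counit_cell by (auto simp: Hom_def)

text \<open>Unit and counit of the adjunction between composing with f and composing with fs on the
  left. The hypothesis of comonadicity concerns composition on the right; this second adjunction is
  what turns coalgebra structures on fs into endomorphisms of \<open>f \<star> fs\<close>.\<close>

definition coev :: "'f \<Rightarrow> 'c" where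
  "coev y = Assoc B fs f y \<cdot> ((\<eta> \<odot> ident B y) \<cdot> inv_arr B (Lunit B y))"

definition ev :: "'f \<Rightarrow> 'c" where
  "ev y = Lunit B y \<cdot> ((\<epsilon> \<odot> ident B y) \<cdot> inv_arr B (Assoc B f fs y))"

lemma coev_arr [simp]:
  assumes "y \<in> Obj B" "Trg B y = a"
  shows "coev y \<in> Arr B" "Dom B (coev y) = y" "Cod B (coev y) = fs \<star> (f \<star> y)"
  using assms by (auto simp: coev_def)

lemma ev_arr [simp]:
  assumes "y \<in> Obj B" "Trg B y = b"
  shows "ev y \<in> Arr B" "Dom B (ev y) = f \<star> (fs \<star> y)" "Cod B (ev y) = y"
  using assms by (auto simp: ev_def)

lemma coev_natural:
  assumes [simp]: "\<alpha> \<in> Arr B" "Trg B (Dom B \<alpha>) = a"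
  shows "(ident B fs \<odot> (ident B f \<odot> \<alpha>)) \<cdot> coev (Dom B \<alpha>) = coev (Cod B \<alpha>) \<cdot> \<alpha>"
proof -
  let ?x = "Dom B \<alpha>" and ?y = "Cod B \<alpha>"
  have "(ident B fs \<odot> (ident B f \<odot> \<alpha>)) \<cdot> coev ?x =
      Assoc B fs f ?y \<cdot> (((ident B (fs \<star> f) \<odot> \<alpha>) \<cdot> (\<eta> \<odot> ident B ?x)) \<cdot> inv_arr B (Lunit B ?x))"
    using assoc_natural[of \<alpha> "ident B f" "ident B fs"] by (simp add: coev_def flip: comp_assoc)
  also have "\<dots> = Assoc B fs f ?y \<cdot> ((\<eta> \<odot> ident B ?y) \<cdot> ((ident B (One B a) \<odot> \<alpha>) \<cdot>
      inv_arr B (Lunit B ?x)))"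
    by (simp add: interchange_arr flip: comp_assoc)
  also have "\<dots> = coev ?y \<cdot> \<alpha>"
    using lunit_inv_natural[of \<alpha>] by (simp add: coev_def comp_assoc)
  finally show ?thesis .
qed

lemma ev_natural:
  assumes [simp]: "\<alpha> \<in> Arr B" "Trg B (Dom B \<alpha>) = b"
  shows "ev (Cod B \<alpha>) \<cdot> (ident B f \<odot> (ident B fs \<odot> \<alpha>)) = \<alpha> \<cdot> ev (Dom B \<alpha>)"
proof -
  let ?x = "Dom B \<alpha>" and ?y = "Cod B \<alpha>"
  have "ev ?y \<cdot> (ident B f \<odot> (ident B fs \<odot> \<alpha>)) =
      Lunit B ?y \<cdot> (((\<epsilon> \<odot> ident B ?y) \<cdot> (ident B (f \<star> fs) \<odot> \<alpha>)) \<cdot> inv_arr B (Assoc B f fs ?x))"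
    using assoc_inv_natural[of \<alpha> "ident B fs" "ident B f"] by (simp add: ev_def comp_assoc)
  also have "\<dots> = Lunit B ?y \<cdot> (((ident B (One B b) \<odot> \<alpha>) \<cdot> (\<epsilon> \<odot> ident B ?x)) \<cdot>
      inv_arr B (Assoc B f fs ?x))"
    by (simp add: interchange_arr)
  also have "\<dots> = (Lunit B ?y \<cdot> (ident B (One B b) \<odot> \<alpha>)) \<cdot>
      ((\<epsilon> \<odot> ident B ?x) \<cdot> inv_arr B (Assoc B f fs ?x))"
    by (simp add: comp_assoc)
  also have "\<dots> = \<alpha> \<cdot> ev ?x"
    using lunit_natural[of \<alpha>] by (simp add: ev_def comp_assoc)
  finally show ?thesis .
qed

text \<open>Coevaluation and evaluation at a composite are whiskerings of those at its left factor. With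
  these two lemmas the triangle identities below reduce to the ones of the adjunction itself.\<close>

lemma coev_hcomp:
  assumes [simp]: "y \<in> Obj B" "z \<in> Obj B" "Trg B y = a" "Trg B z = Src B y"
  shows "(ident B fs \<odot> Assoc B f y z) \<cdot> (Assoc B fs (f \<star> y) z \<cdot> (coev y \<odot> ident B z)) =
      coev (y \<star> z)"
proof -
  have *: "inv_arr B (Lunit B (y \<star> z)) =
      Assoc B (One B a) y z \<cdot> inv_arr B (Lunit B y \<odot> ident B z)"
    using iso_arr_square[of "Lunit B (y \<star> z)" "Assoc B (One B a) y z" "ident B (y \<star> z)"
        "Lunit B y \<odot> ident B z"]
      lunit_hcomp[of y z] by (simp add: hcomp_iso iso_arr_ident)
  have inv_id: "inv_arr B (ident B z) = ident B z"
    by (rule iso_arrI(2)) auto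
  have "(ident B fs \<odot> Assoc B f y z) \<cdot> (Assoc B fs (f \<star> y) z \<cdot> (coev y \<odot> ident B z)) =
      ((ident B fs \<odot> Assoc B f y z) \<cdot> (Assoc B fs (f \<star> y) z \<cdot> (Assoc B fs f y \<odot> ident B z))) \<cdot>
      (((\<eta> \<odot> ident B y) \<odot> ident B z) \<cdot> (inv_arr B (Lunit B y) \<odot> ident B z))"
    by (simp add: coev_def whisker_right_comp comp_assoc)
  also have "\<dots> = Assoc B fs f (y \<star> z) \<cdot> ((Assoc B (fs \<star> f) y z \<cdot> ((\<eta> \<odot> ident B y) \<odot> ident B z)) \<cdot>
      (inv_arr B (Lunit B y) \<odot> ident B z))"
    using pentagon'[of z y f fs] by (simp add: comp_assoc)
  also have "\<dots> = Assoc B fs f (y \<star> z) \<cdot> ((\<eta> \<odot> ident B (y \<star> z)) \<cdot> (Assoc B (One B a) y z \<cdot>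
      (inv_arr B (Lunit B y) \<odot> ident B z)))"
    using assoc_natural[of "ident B z" "ident B y" \<eta>] by (simp add: comp_assoc)
  also have "\<dots> = coev (y \<star> z)"
    using * by (simp add: coev_def hcomp_iso iso_arr_ident inv_id)
  finally show ?thesis .
qed

lemma ev_hcomp:
  assumes [simp]: "y \<in> Obj B" "z \<in> Obj B" "Trg B y = b" "Trg B z = Src B y"
  shows "ev (y \<star> z) \<cdot> ((ident B f \<odot> Assoc B fs y z) \<cdot> Assoc B f (fs \<star> y) z) = ev y \<odot> ident B z"
proof -
  let ?a = "Assoc B f fs y \<odot> ident B z"
  have "(ev (y \<star> z) \<cdot> ((ident B f \<odot> Assoc B fs y z) \<cdot> Assoc B f (fs \<star> y) z)) \<cdot> ?a =
      ev (y \<star> z) \<cdot> ((ident B f \<odot> Assoc B fs y z) \<cdot> (Assoc B f (fs \<star> y) z \<cdot> ?a))"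
    by (simp add: comp_assoc)
  also have "\<dots> = Lunit B (y \<star> z) \<cdot> ((\<epsilon> \<odot> ident B (y \<star> z)) \<cdot> Assoc B (f \<star> fs) y z)"
    by (simp add: pentagon' ev_def comp_assoc)
  also have "\<dots> = (Lunit B (y \<star> z) \<cdot> Assoc B (One B b) y z) \<cdot> ((\<epsilon> \<odot> ident B y) \<odot> ident B z)"
    using assoc_natural[of "ident B z" "ident B y" \<epsilon>] by (simp add: comp_assoc)
  also have "\<dots> = (Lunit B y \<odot> ident B z) \<cdot> ((\<epsilon> \<odot> ident B y) \<odot> ident B z)"
    using lunit_hcomp[of y z] by simp
  also have "\<dots> = (ev y \<odot> ident B z) \<cdot> ?a"
    by (simp add: ev_def comp_assoc flip: whisker_right_comp)
  finally show ?thesis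
    by (rule iso_arr_cancel_right) (auto intro!: hcomp_iso iso_arr_ident)
qed

lemma ev_coev:
  assumes [simp]: "y \<in> Obj B" "Trg B y = a"
  shows "ev (f \<star> y) \<cdot> (ident B f \<odot> coev y) = ident B (f \<star> y)"
proof -
  have tri: "ev f \<cdot> (ident B f \<odot> \<eta>) = Runit B f"
    using triangle_left by (simp add: ev_def comp_assoc)
  have "(ev (f \<star> y) \<cdot> (ident B f \<odot> coev y)) \<cdot> ((ident B f \<odot> Lunit B y) \<cdot> Assoc B f (One B a) y) =
      ev (f \<star> y) \<cdot> ((ident B f \<odot> Assoc B fs f y) \<cdot> ((ident B f \<odot> (\<eta> \<odot> ident B y)) \<cdot>
      Assoc B f (One B a) y))"
    by (simp add: coev_def whisker_left_comp comp_assoc)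
       (simp flip: comp_assoc whisker_left_comp)
  also have "\<dots> = (ev (f \<star> y) \<cdot> ((ident B f \<odot> Assoc B fs f y) \<cdot> Assoc B f (fs \<star> f) y)) \<cdot>
      ((ident B f \<odot> \<eta>) \<odot> ident B y)"
    using assoc_natural[of "ident B y" \<eta> "ident B f"] by (simp add: comp_assoc)
  also have "\<dots> = Runit B f \<odot> ident B y"
    by (simp add: ev_hcomp tri flip: whisker_right_comp)
  also have "\<dots> = ident B (f \<star> y) \<cdot> ((ident B f \<odot> Lunit B y) \<cdot> Assoc B f (One B a) y)"
    using triangle[of y f] by simp
  finally show ?thesis
    by (rule iso_arr_cancel_right) (auto intro!: iso_arr_comp hcomp_iso iso_arr_ident)
qed

lemma runit_counit_coev: "Runit B fs \<cdot> ((ident B fs \<odot> \<epsilon>) \<cdot> coev fs) = ident B fs"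
proof -
  have "Runit B fs \<cdot> ((ident B fs \<odot> \<epsilon>) \<cdot> coev fs) =
      (Runit B fs \<cdot> ((ident B fs \<odot> \<epsilon>) \<cdot> (Assoc B fs f fs \<cdot> (\<eta> \<odot> ident B fs)))) \<cdot>
      inv_arr B (Lunit B fs)"
    by (simp add: coev_def comp_assoc)
  also have "\<dots> = ident B fs"
    using triangle_right by (simp add: comp_assoc)
  finally show ?thesis .
qed

lemma coev_ev:
  assumes [simp]: "y \<in> Obj B" "Trg B y = b"
  shows "(ident B fs \<odot> ev y) \<cdot> coev (fs \<star> y) = ident B (fs \<star> y)"
proof -
  have "(ident B fs \<odot> ev y) \<cdot> coev (fs \<star> y) =
      (ident B fs \<odot> (ev y \<cdot> Assoc B f fs y)) \<cdot> (Assoc B fs (f \<star> fs) y \<cdot> (coev fs \<odot> ident B y))"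
    by (simp add: whisker_left_comp comp_assoc coev_hcomp)
  also have "\<dots> = (ident B fs \<odot> Lunit B y) \<cdot>
      (((ident B fs \<odot> (\<epsilon> \<odot> ident B y)) \<cdot> Assoc B fs (f \<star> fs) y) \<cdot> (coev fs \<odot> ident B y))"
    by (simp add: whisker_left_comp comp_assoc ev_def)
  also have "\<dots> = (ident B fs \<odot> Lunit B y) \<cdot>
      ((Assoc B fs (One B b) y \<cdot> ((ident B fs \<odot> \<epsilon>) \<odot> ident B y)) \<cdot> (coev fs \<odot> ident B y))"
    using assoc_natural[of "ident B y" \<epsilon> "ident B fs"] by simp
  also have "\<dots> = ((ident B fs \<odot> Lunit B y) \<cdot> Assoc B fs (One B b) y) \<cdot>
      (((ident B fs \<odot> \<epsilon>) \<odot> ident B y) \<cdot> (coev fs \<odot> ident B y))"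
    by (simp add: comp_assoc)
  also have "\<dots> = (Runit B fs \<cdot> ((ident B fs \<odot> \<epsilon>) \<cdot> coev fs)) \<odot> ident B y"
    using triangle[of y fs] by (simp add: whisker_right_comp)
  also have "\<dots> = ident B (fs \<star> y)"
    by (simp add: runit_counit_coev)
  finally show ?thesis .
qed


section \<open>Comonoid endomorphisms as coalgebra structures\<close>

definition mate :: "'c \<Rightarrow> 'c" where
  "mate \<phi> = (ident B fs \<odot> \<phi>) \<cdot> coev fs"

lemma ev_mate:
  assumes [simp]: "y \<in> Obj B" "Trg B y = a" "g \<in> Arr B" "Dom B g = f \<star> y"
  shows "ev (Cod B g) \<cdot> (ident B f \<odot> ((ident B fs \<odot> g) \<cdot> coev y)) = g"
proof -
  have "ev (Cod B g) \<cdot> (ident B f \<odot> ((ident B fs \<odot> g) \<cdot> coev y)) =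
      (ev (Cod B g) \<cdot> (ident B f \<odot> (ident B fs \<odot> g))) \<cdot> (ident B f \<odot> coev y)"
    by (simp add: whisker_left_comp comp_assoc)
  also have "\<dots> = (g \<cdot> ev (f \<star> y)) \<cdot> (ident B f \<odot> coev y)"
    using ev_natural[of g] by simp
  also have "\<dots> = g"
    by (simp add: comp_assoc ev_coev)
  finally show ?thesis .
qed

lemma mate_ev:
  assumes [simp]: "z \<in> Obj B" "Trg B z = b" "h \<in> Arr B" "Trg B (Dom B h) = a" "Cod B h = fs \<star> z"
  shows "(ident B fs \<odot> (ev z \<cdot> (ident B f \<odot> h))) \<cdot> coev (Dom B h) = h"
proof -
  have "(ident B fs \<odot> (ev z \<cdot> (ident B f \<odot> h))) \<cdot> coev (Dom B h) =
      (ident B fs \<odot> ev z) \<cdot> ((ident B fs \<odot> (ident B f \<odot> h)) \<cdot> coev (Dom B h))"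
    by (simp add: whisker_left_comp comp_assoc)
  also have "\<dots> = (ident B fs \<odot> ev z) \<cdot> (coev (fs \<star> z) \<cdot> h)"
    using coev_natural[of h] by simp
  also have "\<dots> = h"
    by (simp add: coev_ev flip: comp_assoc)
  finally show ?thesis .
qed

lemma transpose_eq_iff:
  assumes "y \<in> Obj B" "Trg B y = a" "g \<in> Arr B" "Dom B g = f \<star> y" "h \<in> Arr B" "Dom B h = f \<star> y"
    "Cod B g = Cod B h"
  shows "(ident B fs \<odot> g) \<cdot> coev y = (ident B fs \<odot> h) \<cdot> coev y \<longleftrightarrow> g = h"
  using ev_mate[of y g] ev_mate[of y h] assms by metis

abbreviation adj_mult :: 'c where
  "adj_mult \<equiv> mon_mult (adj_monoid B f fs \<eta> \<epsilon>)"

abbreviation adj_comult :: 'c where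
  "adj_comult \<equiv> comon_comult (adj_comonoid B f fs \<eta> \<epsilon>)"

lemma adj_mult_eq: "adj_mult = (ident B fs \<odot> ev f) \<cdot> Assoc B fs f (fs \<star> f)"
  by (simp add: adj_monoid_def ev_def whisker_left_comp comp_assoc)

lemma adj_comult_eq: "adj_comult = inv_arr B (Assoc B f fs (f \<star> fs)) \<cdot> (ident B f \<odot> coev fs)"
  by (simp add: adj_comonoid_def coev_def whisker_left_comp comp_assoc)

lemma adj_mult_arr [simp]:
  "adj_mult \<in> Arr B" "Dom B adj_mult = (fs \<star> f) \<star> (fs \<star> f)" "Cod B adj_mult = fs \<star> f"
  by (simp_all add: adj_mult_eq)

lemma adj_comult_arr [simp]:
  "adj_comult \<in> Arr B" "Dom B adj_comult = f \<star> fs" "Cod B adj_comult = (f \<star> fs) \<star> (f \<star> fs)"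
  by (simp_all add: adj_comult_eq)

lemma mate_arr [simp]:
  assumes "\<phi> \<in> Arr B" "Dom B \<phi> = f \<star> fs"
  shows "mate \<phi> \<in> Arr B" "Dom B (mate \<phi>) = fs" "Cod B (mate \<phi>) = fs \<star> Cod B \<phi>"
  using assms by (simp_all add: mate_def)

text \<open>The structure arrow on fs that corresponds to an endomorphism of \<open>f \<star> fs\<close>. It
  is the mate up to bracketing, since the comonad of composing with f and then with fs produces the
  bracketing \<open>(fs \<star> f) \<star> fs\<close>.\<close>

definition coalg :: "'c \<Rightarrow> 'c" where
  "coalg \<phi> = inv_arr B (Assoc B fs f fs) \<cdot> mate \<phi>"

lemma coalg_arr [simp]:
  assumes "\<phi> \<in> Arr B" "Dom B \<phi> = f \<star> fs" "Cod B \<phi> = f \<star> fs"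
  shows "coalg \<phi> \<in> Arr B" "Dom B (coalg \<phi>) = fs" "Cod B (coalg \<phi>) = (fs \<star> f) \<star> fs"
  using assms by (simp_all add: coalg_def)

lemma assoc_coalg:
  assumes "\<phi> \<in> Arr B" "Dom B \<phi> = f \<star> fs" "Cod B \<phi> = f \<star> fs"
  shows "Assoc B fs f fs \<cdot> coalg \<phi> = mate \<phi>"
  using assms by (simp add: coalg_def)

text \<open>The mate of one side of the comonoid law is an iterate of the mate of \<open>\<phi>\<close>: the
  second copy of \<open>\<phi>\<close> is absorbed into a mate by the definition of the comultiplication,
  naturality of the coevaluation moves this mate to the front, and the first copy is absorbed by
  the coevaluation that is left.\<close>

lemma mate_comult_left:
  assumes [simp]: "\<phi> \<in> Arr B" "Dom B \<phi> = f \<star> fs" "Cod B \<phi> = f \<star> fs"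
  shows "mate ((\<phi> \<odot> \<phi>) \<cdot> adj_comult) =
    Assoc B fs (f \<star> fs) (f \<star> fs) \<cdot> ((mate \<phi> \<odot> ident B (f \<star> fs)) \<cdot> mate \<phi>)"
proof -
  let ?Q = "f \<star> fs"
  let ?A = "Assoc B f fs ?Q"
  have "(\<phi> \<odot> \<phi>) \<cdot> adj_comult = (\<phi> \<odot> ident B ?Q) \<cdot> ((ident B ?Q \<odot> \<phi>) \<cdot> adj_comult)"
    by (simp add: interchange_arr flip: comp_assoc)
  also have "(ident B ?Q \<odot> \<phi>) \<cdot> adj_comult = inv_arr B ?A \<cdot> (ident B f \<odot> mate \<phi>)"
  proof -
    have "(ident B ?Q \<odot> \<phi>) \<cdot> adj_comult =
        ((ident B ?Q \<odot> \<phi>) \<cdot> inv_arr B ?A) \<cdot> (ident B f \<odot> coev fs)"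
      by (simp add: adj_comult_eq comp_assoc)
    also have "\<dots> = (inv_arr B ?A \<cdot> (ident B f \<odot> (ident B fs \<odot> \<phi>))) \<cdot> (ident B f \<odot> coev fs)"
      using assoc_inv_natural[of \<phi> "ident B fs" "ident B f"] by simp
    finally show ?thesis
      by (simp add: mate_def whisker_left_comp comp_assoc)
  qed
  finally have "mate ((\<phi> \<odot> \<phi>) \<cdot> adj_comult) =
      (ident B fs \<odot> (\<phi> \<odot> ident B ?Q)) \<cdot> ((ident B fs \<odot> inv_arr B ?A) \<cdot>
      ((ident B fs \<odot> (ident B f \<odot> mate \<phi>)) \<cdot> coev fs))"
    by (simp add: mate_def[of "_ \<cdot> _"] whisker_left_comp comp_assoc)
  also have "\<dots> = (ident B fs \<odot> (\<phi> \<odot> ident B ?Q)) \<cdot>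
      ((ident B fs \<odot> inv_arr B ?A) \<cdot> (coev (fs \<star> ?Q) \<cdot> mate \<phi>))"
    using coev_natural[of "mate \<phi>"] by simp
  also have "\<dots> = (ident B fs \<odot> (\<phi> \<odot> ident B ?Q)) \<cdot>
      (((ident B fs \<odot> inv_arr B ?A) \<cdot> coev (fs \<star> ?Q)) \<cdot> mate \<phi>)"
    by (simp add: comp_assoc)
  also have "(ident B fs \<odot> inv_arr B ?A) \<cdot> coev (fs \<star> ?Q) =
      Assoc B fs ?Q ?Q \<cdot> (coev fs \<odot> ident B ?Q)"
  proof -
    have "(ident B fs \<odot> inv_arr B ?A) \<cdot> coev (fs \<star> ?Q) = (ident B fs \<odot> inv_arr B ?A) \<cdot>
        ((ident B fs \<odot> ?A) \<cdot> (Assoc B fs ?Q ?Q \<cdot> (coev fs \<odot> ident B ?Q)))"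
      using coev_hcomp[of fs ?Q] by simp
    also have "\<dots> = ((ident B fs \<odot> inv_arr B ?A) \<cdot> (ident B fs \<odot> ?A)) \<cdot>
        (Assoc B fs ?Q ?Q \<cdot> (coev fs \<odot> ident B ?Q))"
      by (simp add: comp_assoc)
    also have "(ident B fs \<odot> inv_arr B ?A) \<cdot> (ident B fs \<odot> ?A) = ident B (fs \<star> (?Q \<star> ?Q))"
      by (simp flip: whisker_left_comp)
    finally show ?thesis by simp
  qed
  also have "(ident B fs \<odot> (\<phi> \<odot> ident B ?Q)) \<cdot>
      ((Assoc B fs ?Q ?Q \<cdot> (coev fs \<odot> ident B ?Q)) \<cdot> mate \<phi>) =
      ((ident B fs \<odot> (\<phi> \<odot> ident B ?Q)) \<cdot> Assoc B fs ?Q ?Q) \<cdot> ((coev fs \<odot> ident B ?Q) \<cdot> mate \<phi>)"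
    by (simp add: comp_assoc)
  also have "\<dots> = (Assoc B fs ?Q ?Q \<cdot> ((ident B fs \<odot> \<phi>) \<odot> ident B ?Q)) \<cdot>
      ((coev fs \<odot> ident B ?Q) \<cdot> mate \<phi>)"
    using assoc_natural[of "ident B ?Q" \<phi> "ident B fs"] by simp
  also have "\<dots> = Assoc B fs ?Q ?Q \<cdot> ((mate \<phi> \<odot> ident B ?Q) \<cdot> mate \<phi>)"
    by (simp add: mate_def[of \<phi>] whisker_right_comp comp_assoc)
  finally show ?thesis .
qed

lemma mate_comult_right:
  assumes "\<phi> \<in> Arr B" "Dom B \<phi> = f \<star> fs" "Cod B \<phi> = f \<star> fs"
  shows "mate (adj_comult \<cdot> \<phi>) = (ident B fs \<odot> adj_comult) \<cdot> mate \<phi>"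
  using assms by (simp add: mate_def whisker_left_comp comp_assoc)

text \<open>The coassociativity law takes place in \<open>(((fs \<star> f) \<star> fs) \<star> f) \<star> fs\<close>,
  the mates of the comonoid law in \<open>fs \<star> ((f \<star> fs) \<star> (f \<star> fs))\<close>. The
  constraint isomorphism between the two identifies the equations side by side.\<close>

definition rebracket :: 'c where
  "rebracket = Assoc B fs (f \<star> fs) (f \<star> fs) \<cdot>
     ((Assoc B fs f fs \<odot> ident B (f \<star> fs)) \<cdot> Assoc B ((fs \<star> f) \<star> fs) f fs)"

lemma rebracket_arr [simp]:
  "iso_arr B rebracket" "rebracket \<in> Arr B" "Dom B rebracket = (((fs \<star> f) \<star> fs) \<star> f) \<star> fs"
  "Cod B rebracket = fs \<star> ((f \<star> fs) \<star> (f \<star> fs))"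
  by (auto simp: rebracket_def intro!: iso_arr_comp hcomp_iso iso_arr_ident)

lemma precomp_unit_arr [simp]:
  assumes "x \<in> Obj B" "Src B x = a"
  shows "precomp_unit B f fs \<eta> x \<in> Arr B" "Dom B (precomp_unit B f fs \<eta> x) = x"
    "Cod B (precomp_unit B f fs \<eta> x) = (x \<star> fs) \<star> f"
  using assms by (simp_all add: precomp_unit_def)

lemma precomp_counit_arr [simp]:
  assumes "y \<in> Obj B" "Src B y = b"
  shows "precomp_counit B f fs \<epsilon> y \<in> Arr B" "Dom B (precomp_counit B f fs \<epsilon> y) = (y \<star> f) \<star> fs"
    "Cod B (precomp_counit B f fs \<epsilon> y) = y"
  using assms by (simp_all add: precomp_counit_def)

lemma whisker_right_iso:
  assumes "iso_arr B h" "g \<in> Obj B" "Trg B g = Src B (Dom B h)"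
  shows "inv_arr B h \<odot> ident B g = inv_arr B (h \<odot> ident B g)"
    "iso_arr B (h \<odot> ident B g)"
proof -
  have "inv_arr B (ident B g) = ident B g"
    using assms by (intro iso_arrI(2)) auto
  then show "inv_arr B h \<odot> ident B g = inv_arr B (h \<odot> ident B g)" "iso_arr B (h \<odot> ident B g)"
    using assms hcomp_iso[of "ident B g" h] iso_arr_ident by auto
qed

text \<open>The comultiplication of the comonad inserts \<open>\<eta>\<close> as a right unit of
  \<open>fs \<star> f\<close>, the coevaluation as a left unit of fs. The pentagon and the triangle say
  that this is the same.\<close>

lemma assoc_precomp_unit:
  "Assoc B (fs \<star> f) fs (f \<star> fs) \<cdot> (Assoc B ((fs \<star> f) \<star> fs) f fs \<cdot>
      (precomp_unit B f fs \<eta> (fs \<star> f) \<odot> ident B fs)) =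
    ident B (fs \<star> f) \<odot> coev fs"
proof -
  let ?S = "fs \<star> f"
  have "Assoc B ?S fs (f \<star> fs) \<cdot> (Assoc B (?S \<star> fs) f fs \<cdot>
      (precomp_unit B f fs \<eta> ?S \<odot> ident B fs)) =
      (Assoc B ?S fs (f \<star> fs) \<cdot> Assoc B (?S \<star> fs) f fs) \<cdot>
      ((inv_arr B (Assoc B ?S fs f) \<odot> ident B fs) \<cdot>
      (((ident B ?S \<odot> \<eta>) \<odot> ident B fs) \<cdot> (inv_arr B (Runit B ?S) \<odot> ident B fs)))"
    by (simp add: precomp_unit_def whisker_right_comp comp_assoc)
  also have "\<dots> = (ident B ?S \<odot> Assoc B fs f fs) \<cdot>
      (Assoc B ?S ?S fs \<cdot> (((ident B ?S \<odot> \<eta>) \<odot> ident B fs) \<cdot>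
      (inv_arr B (Runit B ?S) \<odot> ident B fs)))"
    by (simp add: comp_assoc whisker_right_iso flip: pentagon')
  also have "\<dots> = (ident B ?S \<odot> Assoc B fs f fs) \<cdot>
      ((Assoc B ?S ?S fs \<cdot> ((ident B ?S \<odot> \<eta>) \<odot> ident B fs)) \<cdot>
      (inv_arr B (Runit B ?S) \<odot> ident B fs))"
    by (simp add: comp_assoc)
  also have "\<dots> = (ident B ?S \<odot> Assoc B fs f fs) \<cdot>
      ((ident B ?S \<odot> (\<eta> \<odot> ident B fs)) \<cdot> (Assoc B ?S (One B a) fs \<cdot>
      (inv_arr B (Runit B ?S) \<odot> ident B fs)))"
    using assoc_natural[of "ident B fs" \<eta> "ident B ?S"] by (simp add: comp_assoc)
  also have "Assoc B ?S (One B a) fs \<cdot> (inv_arr B (Runit B ?S) \<odot> ident B fs) =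
      ident B ?S \<odot> inv_arr B (Lunit B fs)"
  proof -
    have "(ident B ?S \<odot> Lunit B fs) \<cdot>
        (Assoc B ?S (One B a) fs \<cdot> (inv_arr B (Runit B ?S) \<odot> ident B fs)) =
       (Runit B ?S \<odot> ident B fs) \<cdot> (inv_arr B (Runit B ?S) \<odot> ident B fs)"
      using triangle[of fs ?S] by (simp flip: comp_assoc)
    also have "\<dots> = (ident B ?S \<odot> Lunit B fs) \<cdot> (ident B ?S \<odot> inv_arr B (Lunit B fs))"
      by (simp add: interchange_arr)
    finally show ?thesis
      by (rule iso_arr_cancel_left) (auto intro!: hcomp_iso iso_arr_ident)
  qed
  finally show ?thesis
    by (simp add: coev_def whisker_left_comp comp_assoc)
qed

lemma rebracket_precomp_unit:
  "rebracket \<cdot> (precomp_unit B f fs \<eta> (fs \<star> f) \<odot> ident B fs) =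
    (ident B fs \<odot> adj_comult) \<cdot> Assoc B fs f fs"
proof -
  let ?S = "fs \<star> f" and ?Q = "f \<star> fs"
  let ?A = "Assoc B f fs ?Q"
  let ?u = "precomp_unit B f fs \<eta> ?S \<odot> ident B fs"
  have "(ident B fs \<odot> ?A) \<cdot> (rebracket \<cdot> ?u) =
      ((ident B fs \<odot> ?A) \<cdot> (Assoc B fs ?Q ?Q \<cdot> (Assoc B fs f fs \<odot> ident B ?Q))) \<cdot>
      (Assoc B (?S \<star> fs) f fs \<cdot> ?u)"
    by (simp add: rebracket_def comp_assoc)
  also have "\<dots> = Assoc B fs f (fs \<star> ?Q) \<cdot> (ident B ?S \<odot> coev fs)"
    by (simp add: pentagon' comp_assoc assoc_precomp_unit)
  also have "\<dots> = (ident B fs \<odot> (ident B f \<odot> coev fs)) \<cdot> Assoc B fs f fs"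
    using assoc_natural[of "coev fs" "ident B f" "ident B fs"] by simp
  also have "\<dots> = (ident B fs \<odot> ?A) \<cdot> ((ident B fs \<odot> adj_comult) \<cdot> Assoc B fs f fs)"
    by (simp add: adj_comult_eq flip: whisker_left_comp comp_assoc[of "Assoc B fs f fs"])
  finally show ?thesis
    by (rule iso_arr_cancel_left) (auto intro!: hcomp_iso iso_arr_ident)
qed

lemma rebracket_coalg:
  assumes [simp]: "\<phi> \<in> Arr B" "Dom B \<phi> = f \<star> fs" "Cod B \<phi> = f \<star> fs"
  shows "rebracket \<cdot> (((coalg \<phi> \<odot> ident B f) \<odot> ident B fs) \<cdot> coalg \<phi>) =
      mate ((\<phi> \<odot> \<phi>) \<cdot> adj_comult)"
proof -
  let ?S = "fs \<star> f" and ?Q = "f \<star> fs"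
  have "rebracket \<cdot> (((coalg \<phi> \<odot> ident B f) \<odot> ident B fs) \<cdot> coalg \<phi>) =
      Assoc B fs ?Q ?Q \<cdot> ((Assoc B fs f fs \<odot> ident B ?Q) \<cdot>
      ((Assoc B (?S \<star> fs) f fs \<cdot> ((coalg \<phi> \<odot> ident B f) \<odot> ident B fs)) \<cdot> coalg \<phi>))"
    by (simp add: rebracket_def comp_assoc)
  also have "\<dots> = Assoc B fs ?Q ?Q \<cdot>
      ((Assoc B fs f fs \<odot> ident B ?Q) \<cdot> ((coalg \<phi> \<odot> ident B ?Q) \<cdot> mate \<phi>))"
    using assoc_natural[of "ident B fs" "ident B f" "coalg \<phi>"]
    by (simp add: comp_assoc assoc_coalg)
  also have "\<dots> = Assoc B fs ?Q ?Q \<cdot> (((Assoc B fs f fs \<cdot> coalg \<phi>) \<odot> ident B ?Q) \<cdot> mate \<phi>)"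
    by (simp add: whisker_right_comp comp_assoc)
  finally show ?thesis
    by (simp add: assoc_coalg mate_comult_left)
qed

text \<open>Both sides of the coassociativity law become, after the invertible rebracketing, the mates
  of the two sides of the comonoid law, and taking mates is injective.\<close>

lemma coassociative_iff:
  assumes [simp]: "\<phi> \<in> Arr B" "Dom B \<phi> = f \<star> fs" "Cod B \<phi> = f \<star> fs"
  shows "((coalg \<phi> \<odot> ident B f) \<odot> ident B fs) \<cdot> coalg \<phi> =
      (precomp_unit B f fs \<eta> (fs \<star> f) \<odot> ident B fs) \<cdot> coalg \<phi> \<longleftrightarrow>
    (\<phi> \<odot> \<phi>) \<cdot> adj_comult = adj_comult \<cdot> \<phi>" (is "?l = ?r \<longleftrightarrow> _")
proof -
  have "rebracket \<cdot> ?r = mate (adj_comult \<cdot> \<phi>)"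
    by (simp add: rebracket_precomp_unit comp_assoc assoc_coalg mate_comult_right
        flip: comp_assoc[of "coalg \<phi>" _ rebracket])
  moreover have "?l = ?r \<longleftrightarrow> rebracket \<cdot> ?l = rebracket \<cdot> ?r"
    using iso_arr_cancel_left[of rebracket ?l ?r] by fastforce
  moreover have "mate ((\<phi> \<odot> \<phi>) \<cdot> adj_comult) =
      mate (adj_comult \<cdot> \<phi>) \<longleftrightarrow> (\<phi> \<odot> \<phi>) \<cdot> adj_comult = adj_comult \<cdot> \<phi>"
    unfolding mate_def by (rule transpose_eq_iff) auto
  ultimately show ?thesis
    by (simp add: rebracket_coalg)
qed

lemma counit_coalg:
  assumes [simp]: "\<phi> \<in> Arr B" "Dom B \<phi> = f \<star> fs" "Cod B \<phi> = f \<star> fs"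
  shows "precomp_counit B f fs \<epsilon> fs \<cdot> coalg \<phi> = Runit B fs \<cdot> ((ident B fs \<odot> (\<epsilon> \<cdot> \<phi>)) \<cdot> coev fs)"
  by (simp add: precomp_counit_def comp_assoc assoc_coalg)
     (simp add: mate_def whisker_left_comp comp_assoc)

text \<open>By the triangle identity for fs, the counit law is the equality of the mates of
  \<open>\<epsilon> \<cdot> \<phi>\<close> and \<open>\<epsilon>\<close>.\<close>

lemma counital_iff:
  assumes [simp]: "\<phi> \<in> Arr B" "Dom B \<phi> = f \<star> fs" "Cod B \<phi> = f \<star> fs"
  shows "precomp_counit B f fs \<epsilon> fs \<cdot> coalg \<phi> = ident B fs \<longleftrightarrow> \<epsilon> \<cdot> \<phi> = \<epsilon>"
proof
  assume "precomp_counit B f fs \<epsilon> fs \<cdot> coalg \<phi> = ident B fs"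
  then have "Runit B fs \<cdot> ((ident B fs \<odot> (\<epsilon> \<cdot> \<phi>)) \<cdot> coev fs) =
      Runit B fs \<cdot> ((ident B fs \<odot> \<epsilon>) \<cdot> coev fs)"
    by (simp add: counit_coalg runit_counit_coev)
  then have "(ident B fs \<odot> (\<epsilon> \<cdot> \<phi>)) \<cdot> coev fs = (ident B fs \<odot> \<epsilon>) \<cdot> coev fs"
    by (rule iso_arr_cancel_left) auto
  then show "\<epsilon> \<cdot> \<phi> = \<epsilon>"
    by (subst (asm) transpose_eq_iff) auto
qed (simp add: counit_coalg runit_counit_coev)


section \<open>Transposes and the product of subobjects\<close>

definition adjunct :: "'c \<Rightarrow> 'c" where
  "adjunct i = precomp_counit B f fs \<epsilon> fs \<cdot> (i \<odot> ident B fs)"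

lemma adjunct_arr [simp]:
  assumes "i \<in> Arr B" "Src B (Dom B i) = a" "Cod B i = fs \<star> f"
  shows "adjunct i \<in> Arr B" "Dom B (adjunct i) = Dom B i \<star> fs" "Cod B (adjunct i) = fs"
  using assms by (simp_all add: adjunct_def)

text \<open>Up to an associator, the arrow whose invertibility defines the class of subobjects is the
  image of the transpose under the right adjoint. Both are made from i by one counit
  \<open>\<epsilon>\<close>, with fs on its left and f on its right.\<close>

lemma adjunct_whisker:
  assumes [simp]: "i \<in> Arr B" "Src B (Dom B i) = a" "Cod B i = fs \<star> f"
  shows "adjunct i \<odot> ident B f = (adj_mult \<cdot> (i \<odot> ident B (fs \<star> f))) \<cdot> Assoc B (Dom B i) fs f"
proof -
  let ?S = "fs \<star> f" and ?Q = "f \<star> fs"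
  have "adjunct i \<odot> ident B f = (Runit B fs \<odot> ident B f) \<cdot> (((ident B fs \<odot> \<epsilon>) \<odot> ident B f) \<cdot>
      ((Assoc B fs f fs \<odot> ident B f) \<cdot> ((i \<odot> ident B fs) \<odot> ident B f)))"
    by (simp add: adjunct_def precomp_counit_def whisker_right_comp comp_assoc)
  also have "\<dots> = (ident B fs \<odot> Lunit B f) \<cdot>
      ((Assoc B fs (One B b) f \<cdot> ((ident B fs \<odot> \<epsilon>) \<odot> ident B f)) \<cdot>
      ((Assoc B fs f fs \<odot> ident B f) \<cdot> ((i \<odot> ident B fs) \<odot> ident B f)))"
    using triangle[of f fs, symmetric] by (simp add: comp_assoc)
  also have "\<dots> = ((ident B fs \<odot> Lunit B f) \<cdot> (ident B fs \<odot> (\<epsilon> \<odot> ident B f))) \<cdot> ((Assoc B fs ?Q f \<cdot>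
      (Assoc B fs f fs \<odot> ident B f)) \<cdot> ((i \<odot> ident B fs) \<odot> ident B f))"
    using assoc_natural[of "ident B f" \<epsilon> "ident B fs"] by (simp add: comp_assoc)
  also have "(ident B fs \<odot> Lunit B f) \<cdot> (ident B fs \<odot> (\<epsilon> \<odot> ident B f)) =
      (ident B fs \<odot> ev f) \<cdot> (ident B fs \<odot> Assoc B f fs f)"
    by (simp add: ev_def comp_assoc flip: whisker_left_comp)
  also have "((ident B fs \<odot> ev f) \<cdot> (ident B fs \<odot> Assoc B f fs f)) \<cdot> ((Assoc B fs ?Q f \<cdot>
      (Assoc B fs f fs \<odot> ident B f)) \<cdot> ((i \<odot> ident B fs) \<odot> ident B f)) =
      (ident B fs \<odot> ev f) \<cdot> (((ident B fs \<odot> Assoc B f fs f) \<cdot> (Assoc B fs ?Q f \<cdot>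
      (Assoc B fs f fs \<odot> ident B f))) \<cdot> ((i \<odot> ident B fs) \<odot> ident B f))"
    by (simp add: comp_assoc)
  also have "\<dots> = adj_mult \<cdot> (Assoc B ?S fs f \<cdot> ((i \<odot> ident B fs) \<odot> ident B f))"
    by (simp add: pentagon' adj_mult_eq comp_assoc)
  also have "\<dots> = (adj_mult \<cdot> (i \<odot> ident B ?S)) \<cdot> Assoc B (Dom B i) fs f"
    using assoc_natural[of "ident B f" "ident B fs" i] by (simp add: comp_assoc)
  finally show ?thesis .
qed

text \<open>The multiplication, whiskered by fs, evaluates the two middle factors of
  \<open>fs \<star> f \<star> fs \<star> f \<star> fs\<close>; so does the evaluation at \<open>f \<star> fs\<close>.\<close>

lemma assoc_mult:
  "Assoc B fs f fs \<cdot> (adj_mult \<odot> ident B fs) = (ident B fs \<odot> ev (f \<star> fs)) \<cdot>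
    ((ident B fs \<odot> (ident B f \<odot> Assoc B fs f fs)) \<cdot>
        (Assoc B fs f ((fs \<star> f) \<star> fs) \<cdot> Assoc B (fs \<star> f) (fs \<star> f) fs))"
proof -
  let ?S = "fs \<star> f" and ?Q = "f \<star> fs"
  have "Assoc B fs f fs \<cdot> (adj_mult \<odot> ident B fs) =
      (Assoc B fs f fs \<cdot> ((ident B fs \<odot> ev f) \<odot> ident B fs)) \<cdot> (Assoc B fs f ?S \<odot> ident B fs)"
    by (simp add: adj_mult_eq whisker_right_comp comp_assoc)
  also have "\<dots> = (ident B fs \<odot> (ev f \<odot> ident B fs)) \<cdot>
      (Assoc B fs (f \<star> ?S) fs \<cdot> (Assoc B fs f ?S \<odot> ident B fs))"
    using assoc_natural[of "ident B fs" "ev f" "ident B fs"] by (simp add: comp_assoc)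
  also have "ev f \<odot> ident B fs = ev ?Q \<cdot> ((ident B f \<odot> Assoc B fs f fs) \<cdot> Assoc B f ?S fs)"
    by (simp add: ev_hcomp)
  finally show ?thesis
    by (simp add: whisker_left_comp comp_assoc pentagon')
qed

text \<open>With the constraints suppressed, the computation runs backwards from
  \<open>(fs \<odot> \<psi>) \<cdot> \<theta> \<cdot> \<beta>\<^sub>i \<cdot> (J\<^sub>i \<odot> \<beta>\<^sub>j)\<close>, where
  \<open>\<theta>\<close> is the structure of \<open>\<phi>\<close>. The factor \<open>\<theta> \<cdot> \<beta>\<^sub>i\<close> is
  \<open>i \<odot> fs\<close>, and it slides past \<open>\<beta>\<^sub>j\<close>. Then \<open>\<psi>\<close> meets
  \<open>\<beta>\<^sub>j\<close>: since \<open>\<psi>\<close> is the evaluation of its mate, the two combine to an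
  evaluation after \<open>j \<odot> fs\<close>. What remains is i and j side by side followed by an evaluation
  in the middle, that is, the multiplication.\<close>

lemma coalg_mult:
  assumes i [simp]: "i \<in> Arr B" "Src B (Dom B i) = a" "Cod B i = fs \<star> f"
    and j [simp]: "j \<in> Arr B" "Src B (Dom B j) = a" "Cod B j = fs \<star> f"
    and \<phi> [simp]: "\<phi> \<in> Arr B" "Dom B \<phi> = f \<star> fs" "Cod B \<phi> = f \<star> fs"
    and \<psi> [simp]: "\<psi> \<in> Arr B" "Dom B \<psi> = f \<star> fs" "Cod B \<psi> = f \<star> fs"
    and i_eq: "i \<odot> ident B fs = coalg \<phi> \<cdot> adjunct i"
    and j_eq: "j \<odot> ident B fs = coalg \<psi> \<cdot> adjunct j"
  shows "(adj_mult \<cdot> (i \<odot> j)) \<odot> ident B fs = coalg (\<psi> \<cdot> \<phi>) \<cdot>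
    (adjunct i \<cdot> ((ident B (Dom B i) \<odot> adjunct j) \<cdot> Assoc B (Dom B i) (Dom B j) fs))"
proof -
  let ?S = "fs \<star> f" and ?Q = "f \<star> fs" and ?I = "Dom B i" and ?J = "Dom B j"
  let ?a = "Assoc B fs f fs"
  have [simp]: "Trg B ?I = a" "Trg B ?J = a"
    using src_trg_cod(2)[of i] src_trg_cod(2)[of j] by simp_all
  have ij: "(i \<odot> ident B fs) \<cdot> (ident B ?I \<odot> adjunct j) =
      (ident B ?S \<odot> adjunct j) \<cdot> (i \<odot> ident B (?J \<star> fs))"
    by (simp add: interchange_arr)
  have \<psi>j: "\<psi> \<cdot> (ident B f \<odot> adjunct j) =
      ev ?Q \<cdot> ((ident B f \<odot> ?a) \<cdot> (ident B f \<odot> (j \<odot> ident B fs)))"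
  proof -
    have "\<psi> \<cdot> (ident B f \<odot> adjunct j) = (ev ?Q \<cdot> (ident B f \<odot> mate \<psi>)) \<cdot> (ident B f \<odot> adjunct j)"
      using ev_mate[of fs \<psi>] by (simp add: mate_def)
    also have "\<dots> = ev ?Q \<cdot> (ident B f \<odot> (?a \<cdot> (coalg \<psi> \<cdot> adjunct j)))"
      by (simp add: whisker_left_comp comp_assoc flip: assoc_coalg)
    finally show ?thesis
      by (simp add: whisker_left_comp comp_assoc flip: j_eq)
  qed
  have "?a \<cdot> (coalg (\<psi> \<cdot> \<phi>) \<cdot> (adjunct i \<cdot> ((ident B ?I \<odot> adjunct j) \<cdot> Assoc B ?I ?J fs))) =
      (?a \<cdot> coalg (\<psi> \<cdot> \<phi>)) \<cdot> (adjunct i \<cdot> ((ident B ?I \<odot> adjunct j) \<cdot> Assoc B ?I ?J fs))"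
    by (simp add: comp_assoc)
  also have "\<dots> = ((ident B fs \<odot> \<psi>) \<cdot> mate \<phi>) \<cdot>
      (adjunct i \<cdot> ((ident B ?I \<odot> adjunct j) \<cdot> Assoc B ?I ?J fs))"
    by (simp add: assoc_coalg mate_def whisker_left_comp comp_assoc)
  also have "\<dots> = (ident B fs \<odot> \<psi>) \<cdot>
      (?a \<cdot> ((coalg \<phi> \<cdot> adjunct i) \<cdot> ((ident B ?I \<odot> adjunct j) \<cdot> Assoc B ?I ?J fs)))"
    by (simp add: comp_assoc flip: assoc_coalg)
  also have "\<dots> = (ident B fs \<odot> \<psi>) \<cdot>
      (?a \<cdot> (((i \<odot> ident B fs) \<cdot> (ident B ?I \<odot> adjunct j)) \<cdot> Assoc B ?I ?J fs))"
    by (simp add: comp_assoc flip: i_eq)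
  also have "\<dots> = (ident B fs \<odot> \<psi>) \<cdot>
      ((?a \<cdot> (ident B ?S \<odot> adjunct j)) \<cdot> ((i \<odot> ident B (?J \<star> fs)) \<cdot> Assoc B ?I ?J fs))"
    unfolding ij by (simp add: comp_assoc)
  also have "?a \<cdot> (ident B ?S \<odot> adjunct j) =
      (ident B fs \<odot> (ident B f \<odot> adjunct j)) \<cdot> Assoc B fs f (?J \<star> fs)"
    using assoc_natural[of "adjunct j" "ident B f" "ident B fs"] by simp
  also have "(i \<odot> ident B (?J \<star> fs)) \<cdot> Assoc B ?I ?J fs =
      Assoc B ?S ?J fs \<cdot> ((i \<odot> ident B ?J) \<odot> ident B fs)"
    using assoc_natural[of "ident B fs" "ident B ?J" i] by simp
  also have "(ident B fs \<odot> \<psi>) \<cdot> (((ident B fs \<odot> (ident B f \<odot> adjunct j)) \<cdot>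
      Assoc B fs f (?J \<star> fs)) \<cdot>
        (Assoc B ?S ?J fs \<cdot> ((i \<odot> ident B ?J) \<odot> ident B fs))) =
      (ident B fs \<odot> (\<psi> \<cdot> (ident B f \<odot> adjunct j))) \<cdot> (Assoc B fs f (?J \<star> fs) \<cdot>
        (Assoc B ?S ?J fs \<cdot> ((i \<odot> ident B ?J) \<odot> ident B fs)))"
    by (simp add: whisker_left_comp comp_assoc)
  also have "\<dots> = (ident B fs \<odot> ev ?Q) \<cdot> ((ident B fs \<odot> (ident B f \<odot> ?a)) \<cdot>
      (((ident B fs \<odot> (ident B f \<odot> (j \<odot> ident B fs))) \<cdot> Assoc B fs f (?J \<star> fs)) \<cdot>
        (Assoc B ?S ?J fs \<cdot> ((i \<odot> ident B ?J) \<odot> ident B fs))))"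
    unfolding \<psi>j by (simp add: whisker_left_comp comp_assoc)
  also have "(ident B fs \<odot> (ident B f \<odot> (j \<odot> ident B fs))) \<cdot> Assoc B fs f (?J \<star> fs) =
      Assoc B fs f (?S \<star> fs) \<cdot> (ident B ?S \<odot> (j \<odot> ident B fs))"
    using assoc_natural[of "j \<odot> ident B fs" "ident B f" "ident B fs"] by simp
  also have "(Assoc B fs f (?S \<star> fs) \<cdot> (ident B ?S \<odot> (j \<odot> ident B fs))) \<cdot>
        (Assoc B ?S ?J fs \<cdot> ((i \<odot> ident B ?J) \<odot> ident B fs)) =
      Assoc B fs f (?S \<star> fs) \<cdot> (((ident B ?S \<odot> (j \<odot> ident B fs)) \<cdot>
        Assoc B ?S ?J fs) \<cdot> ((i \<odot> ident B ?J) \<odot> ident B fs))"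
    by (simp add: comp_assoc)
  also have "(ident B ?S \<odot> (j \<odot> ident B fs)) \<cdot> Assoc B ?S ?J fs =
      Assoc B ?S ?S fs \<cdot> ((ident B ?S \<odot> j) \<odot> ident B fs)"
    using assoc_natural[of "ident B fs" j "ident B ?S"] by simp
  also have "(Assoc B ?S ?S fs \<cdot> ((ident B ?S \<odot> j) \<odot> ident B fs)) \<cdot>
      ((i \<odot> ident B ?J) \<odot> ident B fs) =
      Assoc B ?S ?S fs \<cdot> ((i \<odot> j) \<odot> ident B fs)"
    by (simp add: interchange_arr comp_assoc)
  also have "(ident B fs \<odot> ev ?Q) \<cdot> ((ident B fs \<odot> (ident B f \<odot> ?a)) \<cdot>
      (Assoc B fs f (?S \<star> fs) \<cdot> (Assoc B ?S ?S fs \<cdot> ((i \<odot> j) \<odot> ident B fs)))) =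
      (?a \<cdot> (adj_mult \<odot> ident B fs)) \<cdot> ((i \<odot> j) \<odot> ident B fs)"
    unfolding assoc_mult by (simp add: comp_assoc)
  also have "\<dots> = ?a \<cdot> ((adj_mult \<cdot> (i \<odot> j)) \<odot> ident B fs)"
    by (simp add: whisker_right_comp comp_assoc)
  finally have "?a \<cdot> ((adj_mult \<cdot> (i \<odot> j)) \<odot> ident B fs) =
      ?a \<cdot> (coalg (\<psi> \<cdot> \<phi>) \<cdot> (adjunct i \<cdot> ((ident B ?I \<odot> adjunct j) \<cdot> Assoc B ?I ?J fs)))"
    by (rule sym)
  then show ?thesis
    by (rule iso_arr_cancel_left) auto
qed

end


section \<open>The isomorphism of monoids\<close>

lemma monoid_transport:
  assumes "monoid E" "bij_betw \<Gamma> (carrier I) (carrier E)"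
    and mult: "\<And>x y. \<lbrakk>x \<in> carrier I; y \<in> carrier I\<rbrakk> \<Longrightarrow>
      x \<otimes>\<^bsub>I\<^esub> y \<in> carrier I \<and> \<Gamma> (x \<otimes>\<^bsub>I\<^esub> y) = \<Gamma> x \<otimes>\<^bsub>E\<^esub> \<Gamma> y"
    and one: "\<one>\<^bsub>I\<^esub> \<in> carrier I" "\<Gamma> \<one>\<^bsub>I\<^esub> = \<one>\<^bsub>E\<^esub>"
  shows "monoid I \<and> \<Gamma> \<in> iso I E"
proof
  interpret E: monoid E by (rule assms)
  have inj: "x = y" if "\<Gamma> x = \<Gamma> y" "x \<in> carrier I" "y \<in> carrier I" for x y
    using that assms(2) by (auto simp: bij_betw_def inj_on_def)
  have in_E: "\<Gamma> x \<in> carrier E" if "x \<in> carrier I" for x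
    using that assms(2) by (auto simp: bij_betw_def)
  show "monoid I"
  proof
    fix x y z assume "x \<in> carrier I" "y \<in> carrier I" "z \<in> carrier I"
    then show "x \<otimes>\<^bsub>I\<^esub> y \<otimes>\<^bsub>I\<^esub> z = x \<otimes>\<^bsub>I\<^esub> (y \<otimes>\<^bsub>I\<^esub> z)"
      using mult in_E by (intro inj) (simp_all add: E.m_assoc)
  qed (use mult one in_E in \<open>auto intro!: inj\<close>)
  show "\<Gamma> \<in> iso I E"
    using mult in_E assms(2) by (auto simp: iso_def hom_def)
qed

locale comonadic_bicategory_adjunction = adjunction B a b f fs \<eta> \<epsilon> +
  P: comonadic_adjunction "HomCat B a a" "HomCat B b a" "precomp B fs" "precomp B f"
    "precomp_unit B f fs \<eta>" "precomp_counit B f fs \<epsilon>"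
  for B :: "('o, 'f, 'c) bicat" (structure) and a b f fs \<eta> \<epsilon>
begin

abbreviation End :: "'c monoid" where
  "End \<equiv> comonoid_End B b (adj_comonoid B f fs \<eta> \<epsilon>)"

abbreviation Ir_monoid :: "'c set monoid" where
  "Ir_monoid \<equiv> Ir B a (adj_monoid B f fs \<eta> \<epsilon>)"

abbreviation sub :: "'c \<Rightarrow> 'c set" where
  "sub i \<equiv> subobject (HomCat B a a) i"

lemma End_iff:
  "\<phi> \<in> carrier End \<longleftrightarrow> \<phi> \<in> Arr B \<and> Dom B \<phi> = f \<star> fs \<and> Cod B \<phi> = f \<star> fs \<and>
     (\<phi> \<odot> \<phi>) \<cdot> adj_comult = adj_comult \<cdot> \<phi> \<and> \<epsilon> \<cdot> \<phi> = \<epsilon>"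
  by (auto simp: comonoid_End_def Hom_def) (simp_all add: adj_comonoid_def)

lemma End_ops: "x \<otimes>\<^bsub>End\<^esub> y = x \<cdot> y" "\<one>\<^bsub>End\<^esub> = ident B (f \<star> fs)"
  by (simp_all add: comonoid_End_def adj_comonoid_def)

lemma End_comp:
  assumes "\<phi> \<in> carrier End" "\<psi> \<in> carrier End"
  shows "\<psi> \<cdot> \<phi> \<in> carrier End"
proof -
  note \<phi> = assms(1)[unfolded End_iff] and \<psi> = assms(2)[unfolded End_iff]
  have "((\<psi> \<cdot> \<phi>) \<odot> (\<psi> \<cdot> \<phi>)) \<cdot> adj_comult = ((\<psi> \<odot> \<psi>) \<cdot> (\<phi> \<odot> \<phi>)) \<cdot> adj_comult"
    using \<phi> \<psi> by (simp add: interchange_arr)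
  also have "\<dots> = (\<psi> \<odot> \<psi>) \<cdot> ((\<phi> \<odot> \<phi>) \<cdot> adj_comult)"
    using \<phi> \<psi> by (intro comp_assoc) auto
  also have "\<dots> = (\<psi> \<odot> \<psi>) \<cdot> (adj_comult \<cdot> \<phi>)"
    using \<phi> by simp
  also have "\<dots> = ((\<psi> \<odot> \<psi>) \<cdot> adj_comult) \<cdot> \<phi>"
    using \<phi> \<psi> by (intro comp_assoc[symmetric]) auto
  also have "\<dots> = (adj_comult \<cdot> \<psi>) \<cdot> \<phi>"
    using \<psi> by simp
  also have "\<dots> = adj_comult \<cdot> (\<psi> \<cdot> \<phi>)"
    using \<phi> \<psi> by (intro comp_assoc) auto
  finally have "((\<psi> \<cdot> \<phi>) \<odot> (\<psi> \<cdot> \<phi>)) \<cdot> adj_comult = adj_comult \<cdot> (\<psi> \<cdot> \<phi>)" .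
  moreover have "\<epsilon> \<cdot> (\<psi> \<cdot> \<phi>) = (\<epsilon> \<cdot> \<psi>) \<cdot> \<phi>"
    using \<phi> \<psi> by (intro comp_assoc[symmetric]) auto
  ultimately show ?thesis
    using \<phi> \<psi> by (simp add: End_iff)
qed

lemma End_ident: "ident B (f \<star> fs) \<in> carrier End"
  by (simp add: End_iff)

lemma monoid_End_op: "monoid (opposite_monoid End)"
proof
  fix x y z
  assume "x \<in> carrier (opposite_monoid End)" "y \<in> carrier (opposite_monoid End)"
    "z \<in> carrier (opposite_monoid End)"
  then show "x \<otimes>\<^bsub>opposite_monoid End\<^esub> y \<otimes>\<^bsub>opposite_monoid End\<^esub> z =
      x \<otimes>\<^bsub>opposite_monoid End\<^esub> (y \<otimes>\<^bsub>opposite_monoid End\<^esub> z)"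
    by (simp add: opposite_monoid_def End_ops End_iff comp_assoc)
qed (use End_comp End_ident in \<open>simp_all add: opposite_monoid_def End_ops, simp_all add: End_iff\<close>)

lemma sharp_eq: "P.sharp fs i = adjunct i"
  by (simp add: P.sharp_def adjunct_def)

lemma End_iff_coalgebra:
  assumes [simp]: "\<phi> \<in> Arr B" "Dom B \<phi> = f \<star> fs" "Cod B \<phi> = f \<star> fs"
  shows "\<phi> \<in> carrier End \<longleftrightarrow> coalg \<phi> \<in> P.coalgebra_structures fs"
  by (auto simp: End_iff coalgebras_def comp_functor_def Hom_def
      coassociative_iff counital_iff)

lemma coalg_surj:
  assumes [simp]: "\<theta> \<in> Arr B" "Dom B \<theta> = fs" "Cod B \<theta> = (fs \<star> f) \<star> fs"
  shows "\<exists>\<phi> \<in> Arr B. Dom B \<phi> = f \<star> fs \<and> Cod B \<phi> = f \<star> fs \<and> coalg \<phi> = \<theta>"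
proof -
  let ?\<phi> = "ev (f \<star> fs) \<cdot> (ident B f \<odot> (Assoc B fs f fs \<cdot> \<theta>))"
  have "mate ?\<phi> = Assoc B fs f fs \<cdot> \<theta>"
    using mate_ev[of "f \<star> fs" "Assoc B fs f fs \<cdot> \<theta>"] by (simp add: mate_def)
  then have "coalg ?\<phi> = \<theta>"
    by (simp add: coalg_def)
  then show ?thesis
    by (intro bexI[of _ ?\<phi>]) auto
qed

text \<open>The correspondence between arrows into \<open>fs \<star> f\<close> and comonoid
  endomorphisms is kept as a relation, because several arrows represent one subobject. In it
  \<open>F i\<close> factors through the transpose of i by the structure that belongs to
  \<open>\<phi>\<close>.\<close>

definition classifies :: "'c \<Rightarrow> 'c \<Rightarrow> bool" where
  "classifies \<phi> i \<longleftrightarrow> \<phi> \<in> carrier End \<and> i \<in> Arr B \<and> Src B (Dom B i) = a \<and>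
     Cod B i = fs \<star> f \<and> iso_arr B (adjunct i) \<and> i \<odot> ident B fs = coalg \<phi> \<cdot> adjunct i"

lemma trg_dom_into_carrier [simp]: "i \<in> Arr B \<Longrightarrow> Cod B i = fs \<star> f \<Longrightarrow> Trg B (Dom B i) = a"
  using src_trg_cod(2)[of i] by simp

lemma classifies_induces: "classifies \<phi> i \<longleftrightarrow> \<phi> \<in> carrier End \<and> P.induces i fs (coalg \<phi>)"
  by (auto simp: classifies_def P.induces_def sharp_eq Hom_def End_iff)

text \<open>The coalgebra structure of the identity endomorphism splits the counit at fs, so the right
  adjoint reflects the invertibility of transposes.\<close>

lemma iso_adjunct_iff:
  assumes [simp]: "i \<in> Arr B" "Src B (Dom B i) = a" "Cod B i = fs \<star> f"
  shows "iso_arr B (adj_mult \<cdot> (i \<odot> ident B (fs \<star> f))) \<longleftrightarrow> iso_arr B (adjunct i)"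
proof -
  have "iso_arr B (adj_mult \<cdot> (i \<odot> ident B (fs \<star> f))) \<longleftrightarrow> iso_arr B (adjunct i \<odot> ident B f)"
    by (simp add: adjunct_whisker iso_arr_comp_iff)
  also have "\<dots> \<longleftrightarrow> iso_arr B (adjunct i)"
  proof
    assume "iso_arr B (adjunct i \<odot> ident B f)"
    then have "iso_arr (HomCat B b a) (adjunct i)"
      using counital_iff[of "ident B (f \<star> fs)"]
      by (intro P.U_reflects_iso_to_split[of "Dom B i" _ fs "coalg (ident B (f \<star> fs))"])
         simp_all
    then show "iso_arr B (adjunct i)" by simp
  next
    assume "iso_arr B (adjunct i)"
    then show "iso_arr B (adjunct i \<odot> ident B f)"
      by (intro hcomp_iso iso_arr_ident) auto
  qed
  finally show ?thesis .
qed

lemma classifies_exists: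
  assumes [simp]: "i \<in> Arr B" "Src B (Dom B i) = a" "Cod B i = fs \<star> f"
    and iso: "iso_arr B (adjunct i)"
  shows "\<exists>\<phi>. classifies \<phi> i"
proof -
  obtain \<theta> where \<theta>: "P.induces i fs \<theta>"
    using P.induced_structure_exists[of fs i] iso by (auto simp: sharp_eq)
  then obtain \<phi> where \<phi>: "\<phi> \<in> Arr B" "Dom B \<phi> = f \<star> fs" "Cod B \<phi> = f \<star> fs" "coalg \<phi> = \<theta>"
    using coalg_surj[of \<theta>] by (auto simp: P.induces_def Hom_def)
  moreover have "\<theta> \<in> P.coalgebra_structures fs"
    using \<theta> by (intro P.induced_structure_is_coalgebra) auto
  ultimately show ?thesis
    using \<theta> End_iff_coalgebra by (auto simp: classifies_induces)
qed

lemma classifies_monic: "classifies \<phi> i \<Longrightarrow> monic (HomCat B a a) i"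
  by (rule P.iso_sharp_monic[of fs]) (auto simp: classifies_def sharp_eq)

lemma classifies_surj:
  assumes "\<phi> \<in> carrier End"
  shows "\<exists>i. classifies \<phi> i"
  using P.coalgebra_structure_induced[of fs "coalg \<phi>"] assms End_iff_coalgebra[of \<phi>]
  by (auto simp: classifies_induces End_iff)

lemma classifies_unique:
  assumes "classifies \<phi> i" "classifies \<psi> i"
  shows "\<phi> = \<psi>"
proof -
  have \<phi>: "\<phi> \<in> Arr B" "Dom B \<phi> = f \<star> fs" "Cod B \<phi> = f \<star> fs"
    and \<psi>: "\<psi> \<in> Arr B" "Dom B \<psi> = f \<star> fs" "Cod B \<psi> = f \<star> fs"
    and i: "i \<in> Arr B" "Src B (Dom B i) = a" "Cod B i = fs \<star> f" "iso_arr B (adjunct i)"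
    using assms by (auto simp: classifies_def End_iff)
  have "coalg \<phi> \<cdot> adjunct i = coalg \<psi> \<cdot> adjunct i"
    using assms by (simp add: classifies_def)
  then have "coalg \<phi> = coalg \<psi>"
    by (rule iso_arr_cancel_right) (use \<phi> \<psi> i in auto)
  then have "mate \<phi> = mate \<psi>"
    using \<phi> \<psi> assoc_coalg by metis
  then show ?thesis
    unfolding mate_def by (subst (asm) transpose_eq_iff) (use \<phi> \<psi> in auto)
qed

lemma classifies_same_subobject:
  "classifies \<phi> i \<Longrightarrow> classifies \<phi> j \<Longrightarrow> sub i = sub j"
  by (rule P.induces_same_subobject[of fs]) (auto simp: classifies_induces)

text \<open>Precomposing i with an isomorphism h precomposes both its transpose and its image under F
  with the image of h.\<close>

lemma classifies_representative:
  assumes "classifies \<phi> i" "j \<in> sub i"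
  shows "classifies \<phi> j"
proof -
  obtain h where h: "h \<in> Arr B" "Dom B h = Dom B j" "Cod B h = Dom B i" "iso_arr B h" "i \<cdot> h = j"
    using assms(2) by (auto simp: subobject_def Hom_def)
  have i: "i \<in> Arr B" "Src B (Dom B i) = a" "Cod B i = fs \<star> f" "iso_arr B (adjunct i)"
      "i \<odot> ident B fs = coalg \<phi> \<cdot> adjunct i" "\<phi> \<in> carrier End"
    using assms(1) by (auto simp: classifies_def)
  have src: "Src B (Dom B h) = a" "Trg B (Dom B h) = a"
    using h(1,3) i src_trg_cod[of h] by auto
  have j_eq: "j \<odot> ident B fs = (i \<odot> ident B fs) \<cdot> (h \<odot> ident B fs)"
    using h(1-4) i(1-3) src by (simp add: interchange_arr flip: h(5))
  have adj: "adjunct j = adjunct i \<cdot> (h \<odot> ident B fs)"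
    unfolding adjunct_def j_eq using h(1-3) i(1-3) src by (simp add: comp_assoc)
  have "iso_arr B (adjunct j)"
    unfolding adj using h(1-4) i(1-4) src by (intro iso_arr_comp hcomp_iso iso_arr_ident) auto
  moreover have "j \<odot> ident B fs = coalg \<phi> \<cdot> adjunct j"
    unfolding adj j_eq i(5) using h(1-3) i src by (intro comp_assoc) (auto simp: End_iff)
  moreover have "j \<in> Arr B" "Cod B j = fs \<star> f" "Src B (Dom B j) = a"
    using h i src by auto
  ultimately show ?thesis
    using i(6) by (simp add: classifies_def)
qed

text \<open>The factorisation of \<open>coalg_mult\<close> is the one through the transpose of the product:
  composing it with the counit removes the coalgebra structure.\<close>

lemma classifies_mult:
  assumes "classifies \<phi> i" "classifies \<psi> j"
  shows "classifies (\<psi> \<cdot> \<phi>) (adj_mult \<cdot> (i \<odot> j))"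
proof -
  have i [simp]: "i \<in> Arr B" "Src B (Dom B i) = a" "Cod B i = fs \<star> f" "iso_arr B (adjunct i)"
    and j [simp]: "j \<in> Arr B" "Src B (Dom B j) = a" "Cod B j = fs \<star> f" "iso_arr B (adjunct j)"
    and eqs: "i \<odot> ident B fs = coalg \<phi> \<cdot> adjunct i" "j \<odot> ident B fs = coalg \<psi> \<cdot> adjunct j"
    using assms by (auto simp: classifies_def)
  have \<phi>\<psi>: "\<psi> \<cdot> \<phi> \<in> carrier End"
    using assms End_comp by (auto simp: classifies_def)
  have [simp]: "\<phi> \<in> Arr B" "Dom B \<phi> = f \<star> fs" "Cod B \<phi> = f \<star> fs"
    "\<psi> \<in> Arr B" "Dom B \<psi> = f \<star> fs" "Cod B \<psi> = f \<star> fs"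
    using assms by (auto simp: classifies_def End_iff)
  define \<beta> where "\<beta> = adjunct i \<cdot> ((ident B (Dom B i) \<odot> adjunct j) \<cdot>
      Assoc B (Dom B i) (Dom B j) fs)"
  have \<beta> [simp]: "\<beta> \<in> Arr B" "Cod B \<beta> = fs" and iso: "iso_arr B \<beta>"
    by (auto simp: \<beta>_def intro!: iso_arr_comp hcomp_iso iso_arr_ident)
  have k: "(adj_mult \<cdot> (i \<odot> j)) \<odot> ident B fs = coalg (\<psi> \<cdot> \<phi>) \<cdot> \<beta>"
    unfolding \<beta>_def using eqs by (intro coalg_mult) auto
  have "adjunct (adj_mult \<cdot> (i \<odot> j)) = (precomp_counit B f fs \<epsilon> fs \<cdot> coalg (\<psi> \<cdot> \<phi>)) \<cdot> \<beta>"
    unfolding adjunct_def k by (simp add: comp_assoc)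
  also have "\<dots> = \<beta>"
    using counital_iff[of "\<psi> \<cdot> \<phi>"] \<phi>\<psi> by (simp add: End_iff)
  finally show ?thesis
    using k iso \<phi>\<psi> by (simp add: classifies_def)
qed

text \<open>The transpose of \<open>\<eta>\<close> is a left unit constraint, by a triangle identity.\<close>

lemma classifies_unit: "classifies (ident B (f \<star> fs)) \<eta>"
proof -
  have eq: "\<eta> \<odot> ident B fs = coalg (ident B (f \<star> fs)) \<cdot> Lunit B fs"
    by (simp add: coalg_def mate_def coev_def comp_assoc)
  have "adjunct \<eta> = (precomp_counit B f fs \<epsilon> fs \<cdot> coalg (ident B (f \<star> fs))) \<cdot> Lunit B fs"
    unfolding adjunct_def eq by (simp add: comp_assoc)
  also have "\<dots> = Lunit B fs"
    using counital_iff[of "ident B (f \<star> fs)"] by simp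
  finally show ?thesis
    using eq End_ident by (simp add: classifies_def)
qed

lemma Ir_carrier: "X \<in> carrier Ir_monoid \<longleftrightarrow> (\<exists>\<phi> i. classifies \<phi> i \<and> X = sub i)"
proof
  assume "X \<in> carrier Ir_monoid"
  then obtain i where i: "X = sub i" "monic (HomCat B a a) i" "Cod B i = fs \<star> f"
      "iso_arr B (adj_mult \<cdot> (i \<odot> ident B (fs \<star> f)))"
    by (auto simp: Ir_def adj_monoid_def)
  then have "i \<in> Arr B" "Src B (Dom B i) = a"
    by (auto simp: monic_def)
  with i show "\<exists>\<phi> i. classifies \<phi> i \<and> X = sub i"
    using iso_adjunct_iff classifies_exists by blast
next
  assume "\<exists>\<phi> i. classifies \<phi> i \<and> X = sub i"
  then obtain \<phi> i where i: "classifies \<phi> i" "X = sub i" by blast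
  then have "i \<in> Arr B" "Src B (Dom B i) = a" "Cod B i = fs \<star> f" "iso_arr B (adjunct i)"
    by (auto simp: classifies_def)
  then have "iso_arr (HomCat B a a) (adj_mult \<cdot> (i \<odot> ident B (fs \<star> f)))"
    using iso_adjunct_iff by simp
  with i classifies_monic[OF i(1)] \<open>Cod B i = fs \<star> f\<close> show "X \<in> carrier Ir_monoid"
    unfolding Ir_def by (auto simp: adj_monoid_def)
qed

text \<open>The union over all representatives is a single class, because the products of
  representatives all belong to the same endomorphism.\<close>

lemma Ir_mult:
  assumes "classifies \<phi> i" "classifies \<psi> j"
  shows "sub i \<otimes>\<^bsub>Ir_monoid\<^esub> sub j = sub (adj_mult \<cdot> (i \<odot> j))"
proof -
  have same: "sub (adj_mult \<cdot> (i' \<odot> j')) = sub (adj_mult \<cdot> (i \<odot> j))"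
    if "i' \<in> sub i" "j' \<in> sub j" for i' j'
    using that assms classifies_representative classifies_mult classifies_same_subobject by meson
  have mem: "i \<in> sub i" "j \<in> sub j"
    using assms classifies_monic P.F.C.subobject_refl by blast+
  have "sub i \<otimes>\<^bsub>Ir_monoid\<^esub> sub j = (\<Union>i' \<in> sub i. \<Union>j' \<in> sub j. sub (adj_mult \<cdot> (i' \<odot> j')))"
    by (simp add: Ir_def)
  also have "\<dots> = (\<Union>i' \<in> sub i. \<Union>j' \<in> sub j. sub (adj_mult \<cdot> (i \<odot> j)))"
    by (rule SUP_cong[OF refl], rule SUP_cong[OF refl]) (rule same)
  also have "\<dots> = sub (adj_mult \<cdot> (i \<odot> j))"
    using mem by blast
  finally show ?thesis .
qed

definition \<Gamma> :: "'c set \<Rightarrow> 'c" where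
  "\<Gamma> X = (THE \<phi>. \<exists>i. classifies \<phi> i \<and> X = sub i)"

lemma \<Gamma>_sub:
  assumes "classifies \<phi> i"
  shows "\<Gamma> (sub i) = \<phi>"
  unfolding \<Gamma>_def
proof (rule the_equality)
  fix \<psi> assume "\<exists>j. classifies \<psi> j \<and> sub i = sub j"
  then obtain j where "classifies \<psi> j" "sub i = sub j" by blast
  moreover have "i \<in> sub i"
    using assms classifies_monic P.F.C.subobject_refl by auto
  ultimately show "\<psi> = \<phi>"
    using assms classifies_representative classifies_unique by blast
qed (use assms in auto)

lemma \<Gamma>_bij: "bij_betw \<Gamma> (carrier Ir_monoid) (carrier End)"
proof (rule bij_betw_imageI)
  show "inj_on \<Gamma> (carrier Ir_monoid)"
    by (rule inj_onI) (metis Ir_carrier \<Gamma>_sub classifies_same_subobject)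
  have "\<Gamma> X \<in> carrier End" if "X \<in> carrier Ir_monoid" for X
    using that \<Gamma>_sub by (auto simp: Ir_carrier classifies_def)
  moreover have "\<phi> \<in> \<Gamma> ` carrier Ir_monoid" if "\<phi> \<in> carrier End" for \<phi>
    using classifies_surj[OF that] \<Gamma>_sub Ir_carrier by (metis imageI)
  ultimately show "\<Gamma> ` carrier Ir_monoid = carrier End" by blast
qed

lemma Ir_isomorphic_End_op:
  "monoid Ir_monoid \<and> \<Gamma> \<in> iso Ir_monoid (opposite_monoid End)"
  "\<Gamma> \<one>\<^bsub>Ir_monoid\<^esub> = \<one>\<^bsub>opposite_monoid End\<^esub>"
proof -
  have one: "\<one>\<^bsub>Ir_monoid\<^esub> = sub \<eta>"
    by (simp add: Ir_def adj_monoid_def)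
  show \<Gamma>_one: "\<Gamma> \<one>\<^bsub>Ir_monoid\<^esub> = \<one>\<^bsub>opposite_monoid End\<^esub>"
    using \<Gamma>_sub[OF classifies_unit] by (simp add: one opposite_monoid_def End_ops)
  show "monoid Ir_monoid \<and> \<Gamma> \<in> iso Ir_monoid (opposite_monoid End)"
  proof (rule monoid_transport)
    fix X Y assume "X \<in> carrier Ir_monoid" "Y \<in> carrier Ir_monoid"
    then obtain \<phi> i \<psi> j where "classifies \<phi> i" "X = sub i" "classifies \<psi> j" "Y = sub j"
      by (auto simp: Ir_carrier)
    moreover from this have "classifies (\<psi> \<cdot> \<phi>) (adj_mult \<cdot> (i \<odot> j))"
      using classifies_mult by simp
    ultimately show "X \<otimes>\<^bsub>Ir_monoid\<^esub> Y \<in> carrier Ir_monoid \<and>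
        \<Gamma> (X \<otimes>\<^bsub>Ir_monoid\<^esub> Y) = \<Gamma> X \<otimes>\<^bsub>opposite_monoid End\<^esub> \<Gamma> Y"
      using Ir_mult \<Gamma>_sub Ir_carrier by (auto simp: opposite_monoid_def End_ops)
  next
    show "\<one>\<^bsub>Ir_monoid\<^esub> \<in> carrier Ir_monoid"
      using classifies_unit one by (auto simp: Ir_carrier)
  qed (use monoid_End_op \<Gamma>_bij \<Gamma>_one in \<open>simp_all add: opposite_monoid_def\<close>)
qed

end

theorem theorem2p18:
  fixes B :: "('o, 'f, 'c) bicat" and a b :: 'o and f fs :: 'f and \<eta> \<epsilon> :: 'c
  assumes "bicategory B"
    and "adjunction B a b f fs \<eta> \<epsilon>"
    and "comonadic (HomCat B a a) (HomCat B b a) (precomp B fs) (precomp B f)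
           (precomp_unit B f fs \<eta>) (precomp_counit B f fs \<epsilon>)"
  defines "I \<equiv> Ir B a (adj_monoid B f fs \<eta> \<epsilon>)"
    and "E \<equiv> opposite_monoid (comonoid_End B b (adj_comonoid B f fs \<eta> \<epsilon>))"
  shows "monoid I \<and> monoid E \<and> (\<exists>\<Gamma>. \<Gamma> \<in> iso I E \<and> \<Gamma> \<one>\<^bsub>I\<^esub> = \<one>\<^bsub>E\<^esub>)"
proof -
  interpret adjunction B a b f fs \<eta> \<epsilon>
    by (rule assms)
  interpret P: adjoint_functors "HomCat B a a" "HomCat B b a" "precomp B fs" "precomp B f"
    "precomp_unit B f fs \<eta>" "precomp_counit B f fs \<epsilon>"
    using assms(3) by (simp add: comonadic_def)
  interpret comonadic_bicategory_adjunction B a b f fs \<eta> \<epsilon>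
    using assms(3) by unfold_locales (simp add: comonadic_def)
  show ?thesis
    unfolding I_def E_def using Ir_isomorphic_End_op monoid_End_op by blast
qed

end
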